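(* Let $S$ be a set of $2n$ points in the plane in general position (no three collinear), $n\ge 1$. Then for any two perfect matchings $M$ and $M'$ of $S$ there is a transformation between $M$ and $M'$ of length at most $2\lceil \log_2 n\rceil$.
   Context: A geometric graph has as vertex set a finite set of points in the plane and as edges closed straight-line segments joining pairs of vertices; it is non-crossing if any two edges intersect at most in a common endpoint. A (perfect) matching of a point set is a non-crossing geometric graph on that point set in which every vertex has degree at most one (exactly one). Two non-crossing geometric graphs are compatible if they have the same vertex set and their union is non-crossing. For perfect matchings $M,M'$ of $S$, a transformation between $M$ and $M'$ of length $k$ is a sequence $M=M_0,M_1,\dots,M_k=M'$ of perfect matchings of $S$ such that $M_i$ is compatible with $M_{i+1}$ for all $i\in\{0,\dots,k-1\}$. *)

theory Defs
  imports "HOL-Analysis.Analysis"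
begin

type_synonym point = "real ^ 2"

text \<open>Edges are the closed segments themselves, as point sets.\<close>

record geom_graph =
  verts :: "point set"
  edges :: "point set set"

definition geometric_graph :: "geom_graph \<Rightarrow> bool" where
  "geometric_graph G \<longleftrightarrow>
     finite (verts G) \<and>
     (\<forall>e \<in> edges G. \<exists>u \<in> verts G. \<exists>v \<in> verts G. u \<noteq> v \<and> e = closed_segment u v)"

definition endpoints :: "point set \<Rightarrow> point set" where
  "endpoints e = {u. \<exists>v. e = closed_segment u v}"

lemma endpoints_closed_segment [simp]: "endpoints (closed_segment a b) = {a, b}"
proof -
  have "\<exists>v. closed_segment a b = closed_segment u v" if "u \<in> {a, b}" for u
    using that closed_segment_commute[of a b] by blast
  then show ?thesis
    unfolding endpoints_def by (auto simp: closed_segment_eq doubleton_eq_iff)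
qed

definition non_crossing :: "geom_graph \<Rightarrow> bool" where
  "non_crossing G \<longleftrightarrow>
     (\<forall>e \<in> edges G. \<forall>f \<in> edges G. e \<noteq> f \<longrightarrow> e \<inter> f \<subseteq> endpoints e \<inter> endpoints f)"

definition degree :: "geom_graph \<Rightarrow> point \<Rightarrow> nat" where
  "degree G v = card {e \<in> edges G. v \<in> endpoints e}"

definition perfect_matching :: "point set \<Rightarrow> geom_graph \<Rightarrow> bool" where
  "perfect_matching S G \<longleftrightarrow>
     geometric_graph G \<and> non_crossing G \<and> verts G = S \<and> (\<forall>v \<in> S. degree G v = 1)"

definition graph_union :: "geom_graph \<Rightarrow> geom_graph \<Rightarrow> geom_graph" where
  "graph_union G H = \<lparr>verts = verts G \<union> verts H, edges = edges G \<union> edges H\<rparr>"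

definition compatible :: "geom_graph \<Rightarrow> geom_graph \<Rightarrow> bool" where
  "compatible G H \<longleftrightarrow>
     geometric_graph G \<and> non_crossing G \<and> geometric_graph H \<and> non_crossing H \<and>
     verts G = verts H \<and> non_crossing (graph_union G H)"

definition transformation ::
    "point set \<Rightarrow> geom_graph \<Rightarrow> geom_graph \<Rightarrow> nat \<Rightarrow> (nat \<Rightarrow> geom_graph) \<Rightarrow> bool" where
  "transformation S M M' k Ms \<longleftrightarrow>
     Ms 0 = M \<and> Ms k = M' \<and>
     (\<forall>i \<le> k. perfect_matching S (Ms i)) \<and>
     (\<forall>i < k. compatible (Ms i) (Ms (Suc i)))"

definition general_position :: "point set \<Rightarrow> bool" where
  "general_position S \<longleftrightarrow>
     (\<forall>a \<in> S. \<forall>b \<in> S. \<forall>c \<in> S. a \<noteq> b \<and> b \<noteq> c \<and> a \<noteq> c \<longrightarrow> \<not> collinear {a, b, c})"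

end

theory Submission imports Defs begin

text \<open>
  Fix a direction in which the points of S have distinct heights and cut S by a line perpendicular to
  it into two parts of (almost) equal even size. The key point is that every perfect matching M is
  compatible with a perfect matching having no edge across the cut; iterating this inside the parts,
  all perfect matchings reach one common matching after \<open>\<lceil>log\<^sub>2 n\<rceil>\<close> steps.

  For the key point, call a segment visible if it does not cross M, and consider on one side of the
  cut the sets of visible segments in which every point has odd degree. Such sets exist, since every
  point except the highest is linked by visible segments to a higher one. In a set of minimal total
  length all degrees are 1 and nothing crosses: among three edges at a vertex, two lie on the same
  side of the M-edge there, so the corner they form can be replaced by the shorter taut chain of
  visible segments inside its triangle, and at a crossing two opposite corners can be shortened in
  the same way.
\<close>

section \<open>Orientation and segments\<close>

text \<open>The exchange works with parities rather than with matchings because a replacing chain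
  may run through points that already carry edges, or along edges already chosen. Adding it modulo 2
  keeps every degree odd where it must be and adds at most its own length, whereas degree one would
  be lost at once; degree one is recovered only at the end, from minimality. The corners to be
  shortened need not have their apex in S: it may be a crossing of two edges, the first point at
  which a segment is blocked, or an auxiliary point created by the recursion. So only the two ends
  of a corner are required to lie in S. The chain stays in any convex set containing the corner,
  hence on its side of the cut, even where M has edges across the cut. The target matching depends
  on S and the direction alone, so M and M' both reach it; one of the two walks is then traversed
  backwards, whence the factor 2. Cutting by pairs of points, k rounds reduce up to
  \<open>2 ^ k\<close> pairs to parts with at most one pair, where the matching is unique.\<close>

definition orient :: "point \<Rightarrow> point \<Rightarrow> point \<Rightarrow> real" where
  "orient a b c = (b$1 - a$1) * (c$2 - a$2) - (b$2 - a$2) * (c$1 - a$1)"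

text \<open>Covers both the line functions \<open>orient p q\<close> and the height
  \<open>inner u\<close>.\<close>

definition affine_fun :: "(point \<Rightarrow> real) \<Rightarrow> bool" where
  "affine_fun g \<longleftrightarrow> (\<forall>a b t. g ((1 - t) *\<^sub>R a + t *\<^sub>R b) = (1 - t) * g a + t * g b)"

lemma affine_fun_orient [simp]: "affine_fun (orient p q)"
  unfolding affine_fun_def orient_def by (simp add: algebra_simps)

lemma affine_fun_pos_segment:
  assumes "affine_fun g" "g a > 0" "g b > 0" "w \<in> closed_segment a b"
  shows "g w > 0"
proof -
  obtain t where t: "0 \<le> t" "t \<le> 1" "w = (1 - t) *\<^sub>R a + t *\<^sub>R b"
    using assms(4) by (auto simp: closed_segment_def)
  have "g w = (1 - t) * g a + t * g b" using assms(1) t by (simp add: affine_fun_def)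
  moreover have "(1 - t) * g a + t * g b > 0"
  proof (cases "t = 1")
    case True then show ?thesis using assms by simp
  next
    case False
    then have "(1 - t) * g a > 0" "t * g b \<ge> 0" using t assms by auto
    then show ?thesis by simp
  qed
  ultimately show ?thesis by simp
qed

lemma affine_fun_segment_le_max:
  assumes "affine_fun g" "w \<in> closed_segment a b"
  shows "g w \<le> max (g a) (g b)"
proof -
  obtain t where t: "0 \<le> t" "t \<le> 1" "w = (1 - t) *\<^sub>R a + t *\<^sub>R b"
    using assms(2) by (auto simp: closed_segment_def)
  have "g w = (1 - t) * g a + t * g b" using assms(1) t by (simp add: affine_fun_def)
  also have "\<dots> \<le> max (g a) (g b)"
    using convex_bound_le[of "g a" "max (g a) (g b)" "g b" "1 - t" t] t by simp
  finally show ?thesis .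
qed

lemma affine_fun_zero_on_segment:
  assumes "affine_fun g" "g a > 0" "g b \<le> 0"
  obtains w where "w \<in> closed_segment a b" "g w = 0"
proof
  define t where "t = g a / (g a - g b)"
  have "0 \<le> t" "t \<le> 1" using assms by (auto simp: t_def)
  then show "(1 - t) *\<^sub>R a + t *\<^sub>R b \<in> closed_segment a b"
    by (auto simp: closed_segment_def)
  have "g a - g b \<noteq> 0" using assms by simp
  have "g ((1 - t) *\<^sub>R a + t *\<^sub>R b) = (1 - t) * g a + t * g b"
    using assms(1) by (simp add: affine_fun_def)
  also have "\<dots> = 0" using \<open>g a - g b \<noteq> 0\<close> by (simp add: t_def field_simps)
  finally show "g ((1 - t) *\<^sub>R a + t *\<^sub>R b) = 0" .
qed

lemma orient_eq_0_imp_collinear: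
  assumes "orient a b c = 0"
  shows "collinear {a, b, c}"
proof (cases "a = b")
  case True then show ?thesis by simp
next
  case False
  define d where "d = (if b$1 \<noteq> a$1 then (c$1 - a$1) / (b$1 - a$1) else (c$2 - a$2) / (b$2 - a$2))"
  have ne: "b$1 \<noteq> a$1 \<or> b$2 \<noteq> a$2" using False by (auto simp: vec_eq_iff forall_2)
  have "c - a = d *\<^sub>R (b - a)"
    using assms ne unfolding orient_def d_def
    by (auto simp: vec_eq_iff forall_2 field_simps)
  then have "collinear {0, b - a, c - a}" by (auto simp: collinear_lemma)
  then have "collinear {b, a, c}" by (subst collinear_3) simp
  then show ?thesis by (simp add: insert_commute)
qed

lemma general_position_orient:
  assumes "general_position S" "a \<in> S" "b \<in> S" "c \<in> S" "a \<noteq> b" "b \<noteq> c" "a \<noteq> c"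
  shows "orient a b c \<noteq> 0"
  using assms orient_eq_0_imp_collinear unfolding general_position_def by blast

lemma orient_simps [simp]:
  "orient a a b = 0" "orient a b a = 0" "orient b a a = 0"
  unfolding orient_def by auto

lemma orient_rotate: "orient a b c = orient b c a" "orient a b c = orient c a b"
  unfolding orient_def by algebra+

lemma orient_swap: "orient a b c = - orient b a c" "orient a b c = - orient a c b"
  unfolding orient_def by algebra+

text \<open>\<open>orient\<close> is twice the signed area of a triangle; here the triangle is cut
  into three at z.\<close>

lemma orient_sum: "orient p x q = orient p x z + orient x q z + orient q p z"
  unfolding orient_def by algebra

lemma barycentric:
  "orient p x q *\<^sub>R z = orient x q z *\<^sub>R p + orient q p z *\<^sub>R x + orient p x z *\<^sub>R q"
  by (simp add: vec_eq_iff forall_2 orient_def; algebra)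

text \<open>Pluecker relation for directions at p. If both denominators are positive and
  \<open>orient p x q > 0\<close>, the sign of \<open>orient p c z\<close> compares the slopes
  \<open>orient p x z / orient q p z\<close> and \<open>orient p x c / orient q p c\<close>. The
  next lemma is its counterpart at q.\<close>

lemma orient_cone1:
  "orient p x z * orient q p c - orient q p z * orient p x c = orient p x q * orient p c z"
  unfolding orient_def by algebra

lemma orient_cone2:
  "orient q p z * orient x q c - orient x q z * orient q p c = orient p x q * orient q c z"
  unfolding orient_def by algebra

lemma orient_eq_0_on_segment:
  assumes "w \<in> closed_segment a b" shows "orient a b w = 0"
proof -
  obtain t where "w = (1 - t) *\<^sub>R a + t *\<^sub>R b"
    using assms unfolding closed_segment_def by blast
  then show ?thesis using affine_fun_orient[of a b] by (simp add: affine_fun_def)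
qed

section \<open>Visibility and parity of sets of segments\<close>

definition segments_on :: "point set \<Rightarrow> point set set" where
  "segments_on V = {closed_segment u v | u v. u \<in> V \<and> v \<in> V \<and> u \<noteq> v}"

text \<open>The exception for \<open>m = e\<close> makes the edges of M themselves visible, so a
  join may reuse them.\<close>

definition visible :: "point set set \<Rightarrow> point set \<Rightarrow> bool" where
  "visible M e \<longleftrightarrow> (\<forall>m \<in> M. m \<noteq> e \<longrightarrow> m \<inter> e \<subseteq> endpoints m \<inter> endpoints e)"

text \<open>A set of segments that is odd exactly on T is a T-join. Unlike degrees, parities are
  additive under symmetric difference.\<close>

definition odd_at :: "point set set \<Rightarrow> point \<Rightarrow> bool" where
  "odd_at J v \<longleftrightarrow> odd (card {e \<in> J. v \<in> endpoints e})"

lemma closed_segment_share_endpoint: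
  assumes "orient u v w \<noteq> 0"
  shows "closed_segment u v \<inter> closed_segment u w = {u}"
proof -
  have "z = u" if z: "z \<in> closed_segment u v" "z \<in> closed_segment u w" for z
  proof -
    have 1: "orient u v z = 0" "orient u w z = 0" using z orient_eq_0_on_segment by auto
    obtain t where t: "z = (1 - t) *\<^sub>R u + t *\<^sub>R w"
      using z(2) unfolding closed_segment_def by blast
    have "orient u v z = t * orient u v w" using affine_fun_orient[of u v] t by (simp add: affine_fun_def)
    then have "t = 0" using 1 assms by simp
    then show ?thesis using t by simp
  qed
  then show ?thesis by auto
qed

text \<open>Two distinct segments sharing an endpoint are not collinear in general position, so they
  meet nowhere else. Only pairs with four different endpoints have to be examined.\<close>

lemma segments_meet_only_in_common_endpoint:
  assumes gp: "general_position S" and S: "{a, b, p, q} \<subseteq> S" and ne: "a \<noteq> b" "p \<noteq> q"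
    and neq: "closed_segment a b \<noteq> closed_segment p q"
    and meet: "{a, b} \<inter> {p, q} = {} \<Longrightarrow> closed_segment a b \<inter> closed_segment p q = {}"
  shows "closed_segment a b \<inter> closed_segment p q \<subseteq> {a, b} \<inter> {p, q}"
proof (cases "{a, b} \<inter> {p, q} = {}")
  case True then show ?thesis using meet by simp
next
  case False
  have key: "closed_segment u v \<inter> closed_segment u w = {u}"
    if "u \<in> S" "v \<in> S" "w \<in> S" "u \<noteq> v" "u \<noteq> w" "v \<noteq> w" for u v w
    using closed_segment_share_endpoint general_position_orient[OF gp] that by metis
  from False consider "a = p" | "a = q" | "b = p" | "b = q" by auto
  then show ?thesis
  proof cases
    case 1 then show ?thesis using key[of a b q] S ne neq by auto
  next
    case 2 then show ?thesis using key[of a b p] S ne neq by (auto simp: closed_segment_commute)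
  next
    case 3 then show ?thesis using key[of b a q] S ne neq by (auto simp: closed_segment_commute)
  next
    case 4 then show ?thesis using key[of b a p] S ne neq by (auto simp: closed_segment_commute)
  qed
qed

lemma visibleI:
  assumes gp: "general_position S" and M: "M \<subseteq> segments_on S" and S: "p \<in> S" "q \<in> S" "p \<noteq> q"
    and dis: "\<And>a b. \<lbrakk>closed_segment a b \<in> M; a \<in> S; b \<in> S; a \<noteq> b; {a, b} \<inter> {p, q} = {}\<rbrakk>
      \<Longrightarrow> closed_segment a b \<inter> closed_segment p q = {}"
  shows "visible M (closed_segment p q)"
  unfolding visible_def
proof (intro ballI impI)
  fix m assume m: "m \<in> M" "m \<noteq> closed_segment p q"
  then obtain a b where ab: "m = closed_segment a b" "a \<in> S" "b \<in> S" "a \<noteq> b"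
    using M unfolding segments_on_def by blast
  show "m \<inter> closed_segment p q \<subseteq> endpoints m \<inter> endpoints (closed_segment p q)"
    using segments_meet_only_in_common_endpoint[OF gp, of a b p q] dis[of a b] ab m S by auto
qed

text \<open>A segment of M that meets the open triangle p x q can leave it only through the side p q, so it
  has an endpoint inside. Up to the factor \<open>orient p x q\<close>, the numbers \<open>orient x q z\<close>,
  \<open>orient q p z\<close> and \<open>orient p x z\<close> are the barycentric coordinates of z.\<close>

definition shielded :: "point set set \<Rightarrow> point \<Rightarrow> point \<Rightarrow> point \<Rightarrow> bool" where
  "shielded M p x q \<longleftrightarrow> (\<forall>e \<in> M.
     (\<exists>z \<in> e. orient p x z > 0 \<and> orient x q z > 0 \<and> orient q p z > 0) \<longrightarrow>
     (\<forall>z \<in> e. orient q p z > 0 \<longrightarrow> orient p x z > 0 \<and> orient x q z > 0))"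

section \<open>Symmetric differences: parity and total length\<close>

lemma odd_at_sym_diff:
  assumes "finite A" "finite B"
  shows "odd_at (sym_diff A B) v \<longleftrightarrow> odd_at A v \<noteq> odd_at B v"
proof -
  define P where "P = {e. v \<in> endpoints e}"
  have eq: "{e \<in> X. v \<in> endpoints e} = X \<inter> P" for X by (auto simp: P_def)
  have "card (A \<inter> P) = card ((A - B) \<inter> P) + card (A \<inter> B \<inter> P)"
    using assms by (subst card_Un_disjoint[symmetric]) (auto intro: arg_cong[where f=card])
  moreover have "card (B \<inter> P) = card ((B - A) \<inter> P) + card (A \<inter> B \<inter> P)"
    using assms by (subst card_Un_disjoint[symmetric]) (auto intro: arg_cong[where f=card])
  moreover have "card (sym_diff A B \<inter> P) = card ((A - B) \<inter> P) + card ((B - A) \<inter> P)"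
    using assms by (subst card_Un_disjoint[symmetric]) (auto intro: arg_cong[where f=card])
  ultimately show ?thesis unfolding odd_at_def eq by presburger
qed

lemma sum_sym_diff_le:
  fixes w :: "'a \<Rightarrow> real"
  assumes "finite A" "finite B" "\<And>e. e \<in> A \<union> B \<Longrightarrow> w e \<ge> 0"
  shows "sum w (sym_diff A B) \<le> sum w A + sum w B"
proof -
  have "sum w (sym_diff A B) = sum w (A - B) + sum w (B - A)"
    using assms by (subst sum.union_disjoint) auto
  also have "\<dots> \<le> sum w A + sum w B" using assms by (intro add_mono sum_mono2) auto
  finally show ?thesis .
qed

lemma odd_at_singleton [simp]: "odd_at {closed_segment p q} v \<longleftrightarrow> v \<in> {p, q}"
proof (cases "v \<in> {p, q}")
  case True
  then have "{e \<in> {closed_segment p q}. v \<in> endpoints e} = {closed_segment p q}" by auto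
  then show ?thesis using True by (simp add: odd_at_def)
next
  case False
  then have "{e \<in> {closed_segment p q}. v \<in> endpoints e} = {}" by auto
  then show ?thesis using False by (simp only: odd_at_def) simp
qed

text \<open>Edges are bare point sets, so their length is expressed as a diameter.\<close>

lemma diameter_segment [simp]: "diameter (closed_segment p q) = dist p (q::point)"
proof (rule antisym)
  have "norm (x - y) \<le> dist p q" if x: "x \<in> closed_segment p q" and y: "y \<in> closed_segment p q" for x y
  proof -
    have "norm (x - y) \<le> norm (x - p) \<or> norm (x - y) \<le> norm (x - q)"
      using segment_furthest_le[OF y] by blast
    then show ?thesis using dist_in_closed_segment[OF x] by (auto simp: dist_norm)
  qed
  then show "diameter (closed_segment p q) \<le> dist p q" by (intro diameter_le) auto
  show "dist p q \<le> diameter (closed_segment p q)"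
    by (rule diameter_bounded_bound) (auto simp: bounded_closed_segment)
qed

lemma diameter_segments_on_nonneg: "e \<in> segments_on V \<Longrightarrow> diameter e \<ge> 0"
  unfolding segments_on_def by auto

section \<open>Shortcuts inside a triangle\<close>

text \<open>A segment of M crossing p q enters the open triangle right behind the crossing. Being
  shielded, it must then have its endpoint on that side inside the triangle, where S has no
  point.\<close>

lemma visible_if_triangle_empty:
  assumes gp: "general_position S" and M: "M \<subseteq> segments_on S" and S: "p \<in> S" "q \<in> S"
    and D: "orient p x q > 0" and sh: "shielded M p x q"
    and empty: "\<And>z. z \<in> S \<Longrightarrow> \<not> (orient p x z > 0 \<and> orient x q z > 0 \<and> orient q p z > 0)"
  shows "visible M (closed_segment p q)"
proof (rule visibleI[OF gp M S])
  show "p \<noteq> q" using D by auto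
  fix a b assume ab: "closed_segment a b \<in> M" "a \<in> S" "b \<in> S" "a \<noteq> b" "{a, b} \<inter> {p, q} = {}"
  have main: False
    if e: "closed_segment a b \<in> M" "a \<in> S" "b \<in> S"
      and z: "z \<in> closed_segment a b" "z \<in> closed_segment p q" "z \<noteq> p" "z \<noteq> q"
      and pos: "orient q p a > 0" for a b z
  proof -
    obtain s where s: "0 \<le> s" "s \<le> 1" "z = (1 - s) *\<^sub>R p + s *\<^sub>R q"
      using z(2) unfolding closed_segment_def by blast
    then have s': "0 < s" "s < 1" using z by (auto simp: less_le)
    have "orient p x z = s * orient p x q" "orient x q z = (1 - s) * orient p x q"
      unfolding s(3) orient_def by (simp_all add: algebra_simps)
    then have zpos: "orient p x z > 0" "orient x q z > 0" using s' D by auto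
    have z0: "orient q p z = 0" using orient_eq_0_on_segment[of z q p] z by (simp add: closed_segment_commute)
    \<comment> \<open>The crossing z is interior to the side p q, so moving slightly from z towards
      a leads into the open triangle.\<close>
    define w where "w t = (1 - t) *\<^sub>R z + t *\<^sub>R a" for t :: real
    have lim: "((\<lambda>t. orient u v (w t)) \<longlongrightarrow> orient u v z) (at_right 0)" for u v
    proof -
      have "((\<lambda>t. (1 - t) * orient u v z + t * orient u v a) \<longlongrightarrow> (1 - 0) * orient u v z + 0 * orient u v a) (at_right 0)"
        by (intro tendsto_intros)
      then show ?thesis using affine_fun_orient[of u v] by (simp add: w_def affine_fun_def)
    qed
    have "\<forall>\<^sub>F t in at_right 0. orient p x (w t) > 0 \<and> orient x q (w t) > 0 \<and> t > 0 \<and> t < (1::real)"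
      using order_tendstoD(1)[OF lim zpos(1)] order_tendstoD(1)[OF lim zpos(2)]
        eventually_at_right_less[of "0::real"] eventually_at_right_real[of 0 "1::real", OF zero_less_one]
      by eventually_elim auto
    then obtain t where t: "orient p x (w t) > 0" "orient x q (w t) > 0" "t > 0" "t < 1"
      using eventually_happens'[of "at_right (0::real)"] by auto
    have "orient q p (w t) = t * orient q p a"
      using affine_fun_orient[of q p] z0 by (simp add: w_def affine_fun_def)
    then have "orient q p (w t) > 0" using t pos by simp
    moreover have "w t \<in> closed_segment z a" using t unfolding w_def closed_segment_def by force
    then have "w t \<in> closed_segment a b"
      using subset_closed_segment[of z a a b] z by auto
    ultimately have "\<exists>y\<in>closed_segment a b. orient p x y > 0 \<and> orient x q y > 0 \<and> orient q p y > 0"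
      using t by blast
    moreover have "a \<in> closed_segment a b" by simp
    ultimately have "orient p x a > 0 \<and> orient x q a > 0"
      using sh e pos unfolding shielded_def by blast
    then show False using empty[OF e(2)] pos by blast
  qed
  show "closed_segment a b \<inter> closed_segment p q = {}"
  proof (rule ccontr)
    assume "\<not> ?thesis"
    then obtain z where z: "z \<in> closed_segment a b" "z \<in> closed_segment p q" by auto
    have "orient a b z = 0" using z orient_eq_0_on_segment by blast
    then have zn: "z \<noteq> p" "z \<noteq> q" using general_position_orient[OF gp, of a b p] general_position_orient[OF gp, of a b q] ab S by auto
    have "orient q p z = 0" using orient_eq_0_on_segment[of z q p] z by (simp add: closed_segment_commute)
    then have "\<not> (orient q p a < 0 \<and> orient q p b < 0)"
      using affine_fun_segment_le_max[OF affine_fun_orient z(1), of q p] by auto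
    moreover have "orient q p a \<noteq> 0" "orient q p b \<noteq> 0"
      using general_position_orient[OF gp, of q p] ab S \<open>p \<noteq> q\<close> by auto
    ultimately have "orient q p a > 0 \<or> orient q p b > 0" by linarith
    then show False
      using main[of a b z] main[of b a z] ab z zn by (auto simp: closed_segment_commute)
  qed
qed

text \<open>Here c is the first vertex in the triangle met when the ray from p through x is rotated towards
  q; the segment p c is the first link of the taut chain from p to q.\<close>

lemma no_endpoint_before_first_vertex:
  assumes D: "orient p x q > 0" and sh: "shielded M p x q"
    and c: "orient p x c > 0" "orient x q c > 0" "orient q p c > 0"
    and min: "\<And>z. \<lbrakk>z \<in> S; orient p x z > 0; orient x q z > 0; orient q p z > 0\<rbrakk>
      \<Longrightarrow> orient p c z \<ge> 0"
    and ab: "closed_segment a b \<in> M" "a \<in> S"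
    and w: "w \<in> closed_segment a b" "orient p x w > 0" "orient x q w > 0" "orient q p w > 0" "orient p c w \<le> 0"
  shows "orient p c a \<ge> 0"
proof (rule ccontr)
  assume neg: "\<not> ?thesis"
  have sh': "orient p x z > 0 \<and> orient x q z > 0" if "z \<in> closed_segment a b" "orient q p z > 0" for z
    using sh ab w that unfolding shielded_def by blast
  have a: "a \<in> closed_segment a b" by simp
  have na: "\<not> orient q p a > 0" using sh'[OF a] min[OF ab(2)] neg by auto
  \<comment> \<open>The point a is not strictly on the x side of the line p q, yet strictly on the x
    side of the line p c; so it lies beyond the line p x.\<close>
  have "orient p x a * orient q p c < orient q p a * orient p x c"
    using orient_cone1[of p x a q c] neg D mult_pos_neg[of "orient p x q" "orient p c a"] by auto
  also have "\<dots> \<le> 0" using na c by (intro mult_nonpos_nonneg) auto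
  finally have "orient p x a < 0" using c by (simp add: mult_less_0_iff)
  \<comment> \<open>On its way from w to a the segment meets the line p x at u. There
    \<open>orient q p u\<close> is still positive, which the shield excludes.\<close>
  then obtain u where u: "u \<in> closed_segment w a" "orient p x u = 0"
    using affine_fun_zero_on_segment[OF affine_fun_orient w(2)] by (metis less_imp_le)
  have uab: "u \<in> closed_segment a b" using u w subset_closed_segment[of w a a b] by auto
  have "w \<noteq> u" using u w by auto
  have "orient p c u < 0"
  proof -
    obtain t where t: "0 \<le> t" "t \<le> 1" "u = (1 - t) *\<^sub>R w + t *\<^sub>R a" using u unfolding closed_segment_def by blast
    have "t \<noteq> 0" using t \<open>w \<noteq> u\<close> by auto
    have "orient p c u = (1 - t) * orient p c w + t * orient p c a"
      using affine_fun_orient[of p c] t by (simp add: affine_fun_def)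
    moreover have "(1 - t) * orient p c w \<le> 0" using t w by (intro mult_nonneg_nonpos) auto
    moreover have "t * orient p c a < 0" using t neg \<open>t \<noteq> 0\<close> by (intro mult_pos_neg) auto
    ultimately show ?thesis by linarith
  qed
  then have "0 * orient q p c - orient q p u * orient p x c < 0"
    using orient_cone1[of p x u q c] u D mult_pos_neg[of "orient p x q" "orient p c u"] by simp
  then have "orient q p u > 0" using c by (simp add: zero_less_mult_iff)
  then show False using sh'[OF uab] u by simp
qed

text \<open>If a segment of M meets p c in an interior point, both its endpoints lie on the q side
  of the line p c, strictly so by general position. Then the whole segment lies strictly on that
  side and cannot meet p c.\<close>

lemma visible_first_vertex:
  assumes gp: "general_position S" and M: "M \<subseteq> segments_on S" and S: "p \<in> S" "c \<in> S"
    and D: "orient p x q > 0" and sh: "shielded M p x q"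
    and c: "orient p x c > 0" "orient x q c > 0" "orient q p c > 0"
    and min: "\<And>z. \<lbrakk>z \<in> S; orient p x z > 0; orient x q z > 0; orient q p z > 0\<rbrakk>
      \<Longrightarrow> orient p c z \<ge> 0"
  shows "visible M (closed_segment p c)"
proof (rule visibleI[OF gp M S])
  show "p \<noteq> c" using c by auto
  fix a b assume ab: "closed_segment a b \<in> M" "a \<in> S" "b \<in> S" "a \<noteq> b" "{a, b} \<inter> {p, c} = {}"
  show "closed_segment a b \<inter> closed_segment p c = {}"
  proof (rule ccontr)
    assume "\<not> ?thesis"
    then obtain z where z: "z \<in> closed_segment a b" "z \<in> closed_segment p c" by auto
    have "orient a b z = 0" using z orient_eq_0_on_segment by blast
    then have zn: "z \<noteq> p" "z \<noteq> c"
      using general_position_orient[OF gp, of a b p] general_position_orient[OF gp, of a b c] ab S by auto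
    obtain s where s: "0 \<le> s" "s \<le> 1" "z = (1 - s) *\<^sub>R p + s *\<^sub>R c"
      using z(2) unfolding closed_segment_def by blast
    then have s': "0 < s" "s < 1" using zn by (auto simp: less_le)
    have eq: "orient u v z = (1 - s) * orient u v p + s * orient u v c" for u v
      using affine_fun_orient[of u v] s by (simp add: affine_fun_def)
    have "orient p x z > 0" "orient q p z > 0" using eq[of p x] eq[of q p] s' c by auto
    moreover have "orient x q p > 0" using D by (simp add: orient_rotate)
    then have "orient x q z > 0"
      using affine_fun_pos_segment[OF affine_fun_orient _ c(2) z(2)] by auto
    moreover have h0: "orient p c z = 0" using z orient_eq_0_on_segment by blast
    ultimately have "orient p c a \<ge> 0" "orient p c b \<ge> 0"
      using no_endpoint_before_first_vertex[OF D sh c min, where S=S and a=a and b=b and w=z]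
        no_endpoint_before_first_vertex[OF D sh c min, where S=S and a=b and b=a and w=z] ab z by (auto simp: closed_segment_commute)
    moreover have "orient p c a \<noteq> 0" "orient p c b \<noteq> 0"
      using general_position_orient[OF gp, of p c] ab S \<open>p \<noteq> c\<close> by auto
    ultimately have "orient p c z > 0"
      using affine_fun_pos_segment[OF affine_fun_orient _ _ z(1), of p c] by auto
    then show False using h0 by simp
  qed
qed

lemma affine_fun_nonneg_segment_zero:
  assumes "affine_fun g" "g a \<ge> 0" "g b \<ge> 0" "w \<in> closed_segment a b" "g w \<le> 0"
  shows "(w = a \<and> g a = 0) \<or> (w = b \<and> g b = 0) \<or> (g a = 0 \<and> g b = 0)"
proof -
  obtain t where t: "0 \<le> t" "t \<le> 1" "w = (1 - t) *\<^sub>R a + t *\<^sub>R b"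
    using assms(4) unfolding closed_segment_def by blast
  have "g w = (1 - t) * g a + t * g b" using assms(1) t by (simp add: affine_fun_def)
  moreover have "(1 - t) * g a \<ge> 0" "t * g b \<ge> 0" using t assms by auto
  ultimately have "(1 - t) * g a = 0" "t * g b = 0" using assms(5) by linarith+
  then show ?thesis using t by auto
qed

text \<open>This keeps the recursion going. The apex y will be the point where the line p c meets x
  q, so two sides of the new triangle lie on old lines; only this is recorded, in \<open>y1\<close>
  and \<open>y2\<close>. A segment of M inside cannot leave across x q by the old shield, nor across
  p c because no endpoint lies before the first vertex.\<close>

lemma shielded_first_vertex:
  assumes gp: "general_position S" and M: "M \<subseteq> segments_on S" and S: "p \<in> S" "c \<in> S"
    and D: "orient p x q > 0" and sh: "shielded M p x q"
    and c: "orient p x c > 0" "orient x q c > 0" "orient q p c > 0"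
    and min: "\<And>z. \<lbrakk>z \<in> S; orient p x z > 0; orient x q z > 0; orient q p z > 0\<rbrakk>
      \<Longrightarrow> orient p c z \<ge> 0"
    and y1: "\<And>z. orient c y z > 0 \<longleftrightarrow> orient p c z > 0"
    and y2: "\<And>z. orient y q z > 0 \<longleftrightarrow> orient x q z > 0"
  shows "shielded M c y q"
  unfolding shielded_def y1 y2
proof (intro ballI impI)
  fix e z
  assume e: "e \<in> M" and ex: "\<exists>z\<in>e. 0 < orient p c z \<and> 0 < orient x q z \<and> 0 < orient q c z"
    and z: "z \<in> e" "0 < orient q c z"
  from ex obtain z0 where z0: "z0 \<in> e" "0 < orient p c z0" "0 < orient x q z0" "0 < orient q c z0" by blast
  obtain a b where ab: "e = closed_segment a b" "a \<in> S" "b \<in> S" using e M unfolding segments_on_def by blast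
  have "orient q p z0 * orient x q c > 0"
    using orient_cone2[of q p z0 x c] mult_pos_pos[OF D z0(4)] mult_pos_pos[OF z0(3) c(3)] by linarith
  then have b0: "orient q p z0 > 0" using c by (simp add: zero_less_mult_iff)
  have "orient p x z0 * orient q p c > 0"
    using orient_cone1[of p x z0 q c] mult_pos_pos[OF D z0(2)] mult_pos_pos[OF b0 c(1)] by linarith
  then have c0: "orient p x z0 > 0" using c by (simp add: zero_less_mult_iff)
  have sh': "orient p x u > 0 \<and> orient x q u > 0" if "u \<in> e" "orient q p u > 0" for u
    using sh e z0 b0 c0 that unfolding shielded_def by blast
  have sub: "closed_segment z0 z \<subseteq> e"
    using z z0 unfolding ab by (simp add: subset_closed_segment)
  have bz: "orient q p z > 0"
  proof (rule ccontr)
    \<comment> \<open>A segment leaving across p q while still on the inner side of c q would have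
      to cross the line x q earlier, at a point u where the old shield is still in force.\<close>
    assume nb: "\<not> ?thesis"
    have "orient x q z * orient q p c < orient q p z * orient x q c"
      using orient_cone2[of q p z x c] mult_pos_pos[OF D z(2)] by linarith
    also have "\<dots> \<le> 0" using nb c by (intro mult_nonpos_nonneg) auto
    finally have "orient x q z < 0" using c by (simp add: mult_less_0_iff)
    then obtain u where u: "u \<in> closed_segment z0 z" "orient x q u = 0"
      using affine_fun_zero_on_segment[OF affine_fun_orient z0(3)] by (metis less_imp_le)
    have "orient q c u > 0" using affine_fun_pos_segment[OF affine_fun_orient z0(4) z(2) u(1)] .
    then have "orient q p u * orient x q c > 0"
      using orient_cone2[of q p u x c] mult_pos_pos[OF D, of "orient q c u"] u by simp
    then have "orient q p u > 0" using c by (simp add: zero_less_mult_iff)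
    then show False using sh'[of u] sub u by auto
  qed
  note z' = sh'[OF z(1) bz]
  have "orient p c z > 0"
  proof (rule ccontr)
    assume n: "\<not> ?thesis"
    have "orient p c a \<ge> 0" "orient p c b \<ge> 0"
      using no_endpoint_before_first_vertex[OF D sh c min, where S=S and a=a and b=b and w=z]
        no_endpoint_before_first_vertex[OF D sh c min, where S=S and a=b and b=a and w=z] ab e z z' bz n
      by (auto simp: closed_segment_commute)
    then have "(z = a \<and> orient p c a = 0) \<or> (z = b \<and> orient p c b = 0) \<or> (orient p c a = 0 \<and> orient p c b = 0)"
      using affine_fun_nonneg_segment_zero[OF affine_fun_orient, of p c a b z] z ab n by auto
    moreover have "\<not> (orient p c a = 0 \<and> orient p c b = 0)"
      using affine_fun_segment_le_max[OF affine_fun_orient, of z0 a b p c] z0 ab by auto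
    \<comment> \<open>The segment could still end on the line p c, but the only points of S there
      are p and c, and z is neither.\<close>
    moreover have "orient p c z \<noteq> 0" if "z \<in> S"
    proof -
      have "z \<noteq> p" "z \<noteq> c" "p \<noteq> c" using bz z c by auto
      then show ?thesis using general_position_orient[OF gp S that] by blast
    qed
    ultimately show False using ab by auto
  qed
  then show "0 < orient p c z \<and> 0 < orient x q z" using z' by blast
qed

text \<open>The taut chain is built link by link, by induction on the number of points of S in the
  open triangle: the link p c is split off and the rest is found in the triangle c y q. The apex x
  is not assumed to lie in S, since y usually does not.\<close>

lemma shortcut_ccw:
  assumes fin: "finite S" and gp: "general_position S" and M: "M \<subseteq> segments_on S" and K: "convex K"
    and S: "p \<in> S" "q \<in> S" and inK: "p \<in> K" "x \<in> K" "q \<in> K"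
    and D: "orient p x q > 0" and sh: "shielded M p x q"
  shows "\<exists>F. finite F \<and> F \<subseteq> segments_on (S \<inter> K) \<and> (\<forall>e \<in> F. visible M e) \<and>
           (\<forall>v. odd_at F v \<longleftrightarrow> v \<in> {p, q}) \<and> sum diameter F < dist p x + dist x q"
  using S(1) inK(1,2) D sh
proof (induction "card {z \<in> S. orient p x z > 0 \<and> orient x q z > 0 \<and> orient q p z > 0}"
    arbitrary: p x rule: less_induct)
  case less
  define \<Delta> where "\<Delta> = {z \<in> S. orient p x z > 0 \<and> orient x q z > 0 \<and> orient q p z > 0}"
  have fin\<Delta>: "finite \<Delta>" using fin by (simp add: \<Delta>_def)
  note D = \<open>orient p x q > 0\<close> and sh = \<open>shielded M p x q\<close>
  have pq: "p \<noteq> q" using D by auto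
  show ?case
  proof (cases "\<Delta> = {}")
    case True
    then have "visible M (closed_segment p q)"
      using visible_if_triangle_empty[OF gp M \<open>p \<in> S\<close> S(2) D sh] by (auto simp: \<Delta>_def)
    moreover have "dist p q < dist p x + dist x q"
    proof -
      have "x \<notin> closed_segment p q"
        using orient_eq_0_on_segment[of x p q] D orient_swap(2)[of p x q] by auto
      then have "dist p q \<noteq> dist p x + dist x q" using between between_mem_segment by blast
      then show ?thesis using dist_triangle[of p q x] by simp
    qed
    ultimately show ?thesis
      using less.prems S inK pq
      by (intro exI[of _ "{closed_segment p q}"]) (auto simp: segments_on_def)
  next
    case False
    \<comment> \<open>By \<open>orient_cone1\<close> this ratio grows with the angle by which the
      ray from p has turned from x towards q, so its minimiser is the first vertex met.\<close>
    define r where "r z = orient p x z / orient q p z" for z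
    have "Min (r ` \<Delta>) \<in> r ` \<Delta>" using False fin\<Delta> by simp
    then obtain c where c\<Delta>: "c \<in> \<Delta>" and cmin: "r c = Min (r ` \<Delta>)" by auto
    have cle: "r c \<le> r z" if "z \<in> \<Delta>" for z unfolding cmin using that fin\<Delta> by simp
    have c: "c \<in> S" "orient p x c > 0" "orient x q c > 0" "orient q p c > 0" using c\<Delta> by (auto simp: \<Delta>_def)
    have min: "orient p c z \<ge> 0" if "z \<in> S" "orient p x z > 0" "orient x q z > 0" "orient q p z > 0" for z
    proof -
      have "r c \<le> r z" using cle that by (simp add: \<Delta>_def)
      then have "orient p x z * orient q p c - orient q p z * orient p x c \<ge> 0"
        using that c by (simp add: r_def field_simps)
      then show ?thesis using orient_cone1[of p x z q c] D by (simp add: zero_le_mult_iff)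
    qed
    \<comment> \<open>The point y is where the ray from p through c meets the side x q;
      \<open>s\<close> and \<open>t\<close> are read off from the barycentric coordinates of
      c.\<close>
    define s where "s = orient p x c / (orient q p c + orient p x c)"
    define t where "t = (orient q p c + orient p x c) / orient p x q"
    define y where "y = (1 - s) *\<^sub>R x + s *\<^sub>R q"
    have s: "0 < s" "s < 1" using c by (auto simp: s_def field_simps)
    have t: "0 < t" "t < 1" using c D orient_sum[of p x q c] by (auto simp: t_def field_simps)
    have ceq: "c = (1 - t) *\<^sub>R p + t *\<^sub>R y"
    proof -
      have "1 - t = orient x q c / orient p x q"
        using D orient_sum[of p x q c] by (simp add: t_def field_simps)
      moreover have ne: "orient q p c + orient p x c \<noteq> 0" using c by linarith
      then have "1 - s = orient q p c / (orient q p c + orient p x c)"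
        unfolding s_def by (simp add: diff_divide_eq_iff)
      then have "t * (1 - s) = orient q p c / orient p x q" "t * s = orient p x c / orient p x q"
        using ne by (simp_all add: t_def s_def)
      ultimately have "(1 - t) *\<^sub>R p + t *\<^sub>R y = (1 / orient p x q) *\<^sub>R
         (orient x q c *\<^sub>R p + orient q p c *\<^sub>R x + orient p x c *\<^sub>R q)"
        by (simp add: y_def scaleR_add_right)
      also have "\<dots> = c" using barycentric[of p x q c, symmetric] D by simp
      finally show ?thesis by simp
    qed
    have "orient c y z * t = (1 - t) * orient p c z" for z
      unfolding ceq orient_def by (simp add: algebra_simps)
    then have y1: "orient c y z > 0 \<longleftrightarrow> orient p c z > 0" for z
      using t by (metis diff_gt_0_iff_gt mult.commute zero_less_mult_pos mult_pos_pos)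
    have "orient y q z = (1 - s) * orient x q z" for z
      unfolding y_def orient_def by (simp add: algebra_simps)
    then have y2: "orient y q z > 0 \<longleftrightarrow> orient x q z > 0" for z
      using s by (simp add: zero_less_mult_iff)
    have sh': "shielded M c y q"
      by (rule shielded_first_vertex[OF gp M \<open>p \<in> S\<close> c(1) D sh c(2-4) min y1 y2])
    have vis: "visible M (closed_segment p c)"
      by (rule visible_first_vertex[OF gp M \<open>p \<in> S\<close> c(1) D sh c(2-4) min])
    have yseg: "y \<in> closed_segment x q" using s unfolding y_def closed_segment_def by force
    have cseg: "c \<in> closed_segment p y" using t ceq unfolding closed_segment_def by force
    have yK: "y \<in> K" using K yseg \<open>x \<in> K\<close> inK(3) closed_segment_subset by blast
    have cK: "c \<in> K" using K cseg \<open>p \<in> K\<close> yK closed_segment_subset by blast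
    have "orient p c q > 0"
      using orient_cone1[of p x q q c] D c mult_pos_pos[OF D c(4)] by (simp add: zero_less_mult_iff)
    then have D': "orient c y q > 0" using y1 by simp
    have "{z \<in> S. orient c y z > 0 \<and> orient y q z > 0 \<and> orient q c z > 0} \<subset> \<Delta>"
    proof -
      have "z \<in> \<Delta>" if z: "z \<in> S" "orient p c z > 0" "orient x q z > 0" "orient q c z > 0" for z
      proof -
        have "orient q p z * orient x q c > 0"
          using orient_cone2[of q p z x c] mult_pos_pos[OF D z(4)] mult_pos_pos[OF z(3) c(4)] by linarith
        then have b0: "orient q p z > 0" using c by (simp add: zero_less_mult_iff)
        have "orient p x z * orient q p c > 0"
          using orient_cone1[of p x z q c] mult_pos_pos[OF D z(2)] mult_pos_pos[OF b0 c(2)] by linarith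
        then have c0: "orient p x z > 0" using c by (simp add: zero_less_mult_iff)
        show ?thesis using z b0 c0 by (simp add: \<Delta>_def)
      qed
      then show ?thesis using c\<Delta> unfolding y1 y2 by auto
    qed
    then have "card {z \<in> S. orient c y z > 0 \<and> orient y q z > 0 \<and> orient q c z > 0} < card \<Delta>"
      using fin\<Delta> by (rule psubset_card_mono[rotated])
    from less.hyps[OF this[unfolded \<Delta>_def] c(1) cK yK D' sh']
    obtain F where F: "finite F" "F \<subseteq> segments_on (S \<inter> K)" "\<forall>e\<in>F. visible M e"
      "\<forall>v. odd_at F v = (v \<in> {c, q})" "sum diameter F < dist c y + dist y q" by blast
    have cpq: "c \<noteq> p" "c \<noteq> q" using c by auto
    \<comment> \<open>Should the link p c already occur in F, it cancels; parities remain correct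
      and the length only drops.\<close>
    define G where "G = sym_diff {closed_segment p c} F"
    have "finite G" using F by (simp add: G_def)
    moreover have "closed_segment p c \<in> segments_on (S \<inter> K)"
      using c cK cpq less.prems unfolding segments_on_def by blast
    then have "G \<subseteq> segments_on (S \<inter> K)" using F unfolding G_def by auto
    moreover have "\<forall>e\<in>G. visible M e" using F vis unfolding G_def by auto
    moreover have "odd_at G v = (v \<in> {p, q})" for v
      unfolding G_def using F cpq pq by (subst odd_at_sym_diff) auto
    moreover have "sum diameter G < dist p x + dist x q"
    proof -
      have nn: "diameter e \<ge> 0" if "e \<in> {closed_segment p c} \<union> F" for e
        using that F(2) diameter_segments_on_nonneg[of e "S \<inter> K"] by auto
      have "sum diameter G \<le> dist p c + sum diameter F"
        using sum_sym_diff_le[of "{closed_segment p c}" F diameter, OF _ F(1) nn] unfolding G_def by simp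
      also have "\<dots> < dist p c + (dist c y + dist y q)" using F by simp
      also have "\<dots> = dist p y + dist y q" using cseg by (simp add: between_mem_segment[symmetric] between)
      also have "\<dots> \<le> dist p x + (dist x y + dist y q)" using dist_triangle[of p y x] by simp
      also have "\<dots> = dist p x + dist x q" using yseg by (simp add: between_mem_segment[symmetric] between)
      finally show ?thesis .
    qed
    ultimately show ?thesis by blast
  qed
qed

section \<open>Recognising shielded corners\<close>

lemma affine_fun_pair_zero_on_segment:
  assumes "affine_fun g" "affine_fun h" "g a > 0" "h a > 0" "\<not> (g b > 0 \<and> h b > 0)"
  obtains w where "w \<in> closed_segment a b" "(g w = 0 \<and> h w \<ge> 0) \<or> (h w = 0 \<and> g w \<ge> 0)"
proof -
  define u where "u t = (1 - t) *\<^sub>R a + t *\<^sub>R b" for t :: real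
  have eq: "g (u t) = (1 - t) * g a + t * g b" "h (u t) = (1 - t) * h a + t * h b" for t
    using assms by (auto simp: affine_fun_def u_def)
  \<comment> \<open>A zero of the minimum is an exit from the quadrant where both functions are
    positive: one vanishes while the other is still nonnegative. A zero of a single function could
    lie on the wrong part of its line.\<close>
  have "\<exists>t\<ge>0. t \<le> 1 \<and> min (g (u t)) (h (u t)) = 0"
  proof (rule IVT2')
    show "continuous_on {0..1} (\<lambda>t. min (g (u t)) (h (u t)))"
      unfolding eq by (intro continuous_intros)
  qed (use assms in \<open>auto simp: eq min_def\<close>)
  then obtain t where t: "0 \<le> t" "t \<le> 1" "min (g (u t)) (h (u t)) = 0" by blast
  show thesis
  proof (rule that[of "u t"])
    show "u t \<in> closed_segment a b" using t unfolding u_def closed_segment_def by blast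
    show "(g (u t) = 0 \<and> h (u t) \<ge> 0) \<or> (h (u t) = 0 \<and> g (u t) \<ge> 0)"
      using t(3) by (auto simp: min_def split: if_splits)
  qed
qed

lemma barycentric_segment1:
  assumes D: "orient p x q > 0" and z: "orient p x z = 0" "orient x q z \<ge> 0" "orient q p z \<ge> 0"
  shows "z \<in> closed_segment x p"
proof -
  define t where "t = orient x q z / orient p x q"
  have sum: "orient p x q = orient x q z + orient q p z" using orient_sum[of p x q z] z by simp
  have "z = (1 / orient p x q) *\<^sub>R (orient p x q *\<^sub>R z)" using D by simp
  also have "\<dots> = (orient q p z / orient p x q) *\<^sub>R x + t *\<^sub>R p"
    using barycentric[of p x q z] z by (simp add: t_def scaleR_add_right)
  also have "orient q p z / orient p x q = 1 - t"
    using D unfolding t_def by (simp add: diff_divide_eq_iff sum[symmetric]) (use sum in linarith)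
  finally have "z = (1 - t) *\<^sub>R x + t *\<^sub>R p" .
  moreover have "0 \<le> t" "t \<le> 1" using D z sum by (auto simp: t_def)
  ultimately show ?thesis unfolding closed_segment_def by blast
qed

lemma barycentric_segment2:
  assumes D: "orient p x q > 0" and z: "orient x q z = 0" "orient p x z \<ge> 0" "orient q p z \<ge> 0"
  shows "z \<in> closed_segment x q"
proof -
  define t where "t = orient p x z / orient p x q"
  have sum: "orient p x q = orient p x z + orient q p z" using orient_sum[of p x q z] z by simp
  have "z = (1 / orient p x q) *\<^sub>R (orient p x q *\<^sub>R z)" using D by simp
  also have "\<dots> = (orient q p z / orient p x q) *\<^sub>R x + t *\<^sub>R q"
    using barycentric[of p x q z] z by (simp add: t_def scaleR_add_right)
  also have "orient q p z / orient p x q = 1 - t"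
    using D unfolding t_def by (simp add: diff_divide_eq_iff sum[symmetric]) (use sum in linarith)
  finally have "z = (1 - t) *\<^sub>R x + t *\<^sub>R q" .
  moreover have "0 \<le> t" "t \<le> 1" using D z sum by (auto simp: t_def)
  ultimately show ?thesis unfolding closed_segment_def by blast
qed

text \<open>An orientation-free criterion for \<open>shielded\<close>. The second alternative covers the segments of M
  through the corner x itself.\<close>

definition unobstructed :: "point set \<Rightarrow> point \<Rightarrow> point \<Rightarrow> point \<Rightarrow> bool" where
  "unobstructed m p x q \<longleftrightarrow>
     m \<inter> (closed_segment x p - {p}) = {} \<and> m \<inter> (closed_segment x q - {q}) = {} \<or>
     (\<exists>u. u \<noteq> x \<and> (\<forall>z \<in> m. orient x u z = 0) \<and> orient x u p * orient x u q \<ge> 0)"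

lemma unobstructed_commute: "unobstructed m p x q = unobstructed m q x p"
  unfolding unobstructed_def by (auto simp: mult.commute)

lemma line_misses_triangle:
  assumes D: "orient p x q > 0" and u: "u \<noteq> x" "orient x u p * orient x u q \<ge> 0" "orient x u z = 0"
    and z: "orient p x z > 0" "orient x q z > 0"
  shows False
proof -
  \<comment> \<open>Up to a positive factor, the value at a point of the open angle at x is a
    positive combination of the values at p and q. With these of equal sign it vanishes only if both
    do, which forces \<open>u = x\<close>.\<close>
  have "orient x u z * orient p x q = orient x q z * orient x u p + orient p x z * orient x u q"
    unfolding orient_def by algebra
  then have 0: "orient x q z * orient x u p + orient p x z * orient x u q = 0" using u by simp
  have "orient x u p = 0 \<and> orient x u q = 0"
  proof (rule ccontr)
    assume n: "\<not> ?thesis"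
    have "(orient x u p \<ge> 0 \<and> orient x u q \<ge> 0) \<or> (orient x u p \<le> 0 \<and> orient x u q \<le> 0)"
      using u(2) by (simp add: zero_le_mult_iff)
    then show False
    proof
      assume a: "orient x u p \<ge> 0 \<and> orient x u q \<ge> 0"
      then have "orient x q z * orient x u p \<ge> 0" "orient p x z * orient x u q \<ge> 0" using z by auto
      then have "orient x q z * orient x u p = 0" "orient p x z * orient x u q = 0" using 0 by linarith+
      then show False using n z by auto
    next
      assume a: "orient x u p \<le> 0 \<and> orient x u q \<le> 0"
      then have "orient x q z * orient x u p \<le> 0" "orient p x z * orient x u q \<le> 0"
        using z by (auto intro: mult_nonneg_nonpos)
      then have "orient x q z * orient x u p = 0" "orient p x z * orient x u q = 0" using 0 by linarith+
      then show False using n z by auto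
    qed
  qed
  then have "(u$1 - x$1) * orient p x q = 0" "(u$2 - x$2) * orient p x q = 0"
    unfolding orient_def by algebra+
  then have "u = x" using D by (auto simp: vec_eq_iff forall_2)
  then show False using u by simp
qed

text \<open>Between \<open>z0\<close> and z the segment stays strictly on the x side of the line p
  q. An exit from the angle at x would therefore lie on a side x p or x q and differ from p and q,
  which the first alternative of \<open>unobstructed\<close> forbids.\<close>

lemma shielded_if_unobstructed:
  assumes M: "M \<subseteq> segments_on S" and D: "orient p x q > 0"
    and un: "\<And>m. m \<in> M \<Longrightarrow> unobstructed m p x q"
  shows "shielded M p x q"
  unfolding shielded_def
proof (intro ballI impI)
  fix m z
  assume m: "m \<in> M" and ex: "\<exists>z\<in>m. 0 < orient p x z \<and> 0 < orient x q z \<and> 0 < orient q p z"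
    and z: "z \<in> m" "0 < orient q p z"
  from ex obtain z0 where z0: "z0 \<in> m" "0 < orient p x z0" "0 < orient x q z0" "0 < orient q p z0" by blast
  have "\<not> (\<exists>u. u \<noteq> x \<and> (\<forall>z \<in> m. orient x u z = 0) \<and> orient x u p * orient x u q \<ge> 0)"
    using line_misses_triangle[OF D, of _ z0] z0 by blast
  then have dis: "m \<inter> (closed_segment x p - {p}) = {}" "m \<inter> (closed_segment x q - {q}) = {}"
    using un[OF m] unfolding unobstructed_def by auto
  obtain a b where ab: "m = closed_segment a b" using m M unfolding segments_on_def by blast
  have sub: "closed_segment z0 z \<subseteq> m" using z z0 unfolding ab by (simp add: subset_closed_segment)
  show "0 < orient p x z \<and> 0 < orient x q z"
  proof (rule ccontr)
    assume "\<not> ?thesis"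
    then obtain w where w: "w \<in> closed_segment z0 z"
      "(orient p x w = 0 \<and> orient x q w \<ge> 0) \<or> (orient x q w = 0 \<and> orient p x w \<ge> 0)"
      using affine_fun_pair_zero_on_segment[OF affine_fun_orient affine_fun_orient z0(2,3)] by metis
    have "orient q p w > 0" using affine_fun_pos_segment[OF affine_fun_orient z0(4) z(2) w(1)] .
    moreover from this have "w \<noteq> p" "w \<noteq> q" by auto
    moreover have "w \<in> m" using sub w by auto
    ultimately show False
      using w(2) dis barycentric_segment1[OF D, of w] barycentric_segment2[OF D, of w] by auto
  qed
qed

lemma shortcut:
  assumes "finite S" "general_position S" and M: "M \<subseteq> segments_on S" and "convex K"
    and "p \<in> S" "q \<in> S" "p \<in> K" "x \<in> K" "q \<in> K"
    and D: "orient p x q \<noteq> 0" and un: "\<And>m. m \<in> M \<Longrightarrow> unobstructed m p x q"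
  obtains F where "finite F" "F \<subseteq> segments_on (S \<inter> K)" "\<forall>e \<in> F. visible M e"
    "\<forall>v. odd_at F v \<longleftrightarrow> v \<in> {p, q}" "sum diameter F < dist p x + dist x q"
proof (cases "orient p x q > 0")
  case True
  then have "shielded M p x q" using shielded_if_unobstructed[OF M] un by blast
  from shortcut_ccw[OF assms(1-9) True this] show thesis using that by blast
next
  case False
  \<comment> \<open>A clockwise corner becomes counterclockwise on exchanging p and q; all other
    hypotheses are symmetric.\<close>
  then have D': "orient q x p > 0"
    using D orient_rotate(1)[of p x q] orient_swap(1)[of x q p] by linarith
  then have "shielded M q x p"
    using shielded_if_unobstructed[OF M] un unobstructed_commute by blast
  from shortcut_ccw[OF assms(1-4) assms(6,5,9,8,7) D' this] obtain F where
    F: "finite F" "F \<subseteq> segments_on (S \<inter> K)" "\<forall>e\<in>F. visible M e"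
    "\<forall>v. odd_at F v = (v \<in> {q, p})" "sum diameter F < dist q x + dist x p" by blast
  show thesis using F by (intro that[of F]) (auto simp: dist_commute add.commute)
qed

lemma orient_interior_point:
  assumes "x \<in> closed_segment p q" "x \<noteq> p" "orient p q r \<noteq> 0"
  shows "orient p x r \<noteq> 0"
proof -
  obtain t where t: "x = (1 - t) *\<^sub>R p + t *\<^sub>R q" using assms(1) unfolding closed_segment_def by blast
  then have "t \<noteq> 0" using assms by auto
  moreover have "orient p x r = t * orient p q r" unfolding t orient_def by (simp add: algebra_simps)
  ultimately show ?thesis using assms by simp
qed

lemma far_endpoint_notin_subsegment:
  assumes "x \<in> closed_segment p (q::point)" "x \<noteq> q"
  shows "q \<notin> closed_segment x p"
proof
  assume "q \<in> closed_segment x p"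
  then have "dist q p \<le> dist x p" using dist_in_closed_segment by blast
  moreover have "dist p q = dist p x + dist x q"
    using assms by (simp add: between_mem_segment[symmetric] between)
  ultimately have "dist x q \<le> 0" by (simp add: dist_commute)
  then show False using assms by simp
qed

lemma orient_on_line:
  assumes "p \<noteq> q" "orient p q x = 0" "orient p q z = 0"
  shows "orient x p z = 0"
proof -
  have "(q$1 - p$1) * orient x p z = 0" "(q$2 - p$2) * orient x p z = 0"
    using assms(2,3) unfolding orient_def by algebra+
  then show ?thesis using assms(1) by (auto simp: vec_eq_iff forall_2)
qed

section \<open>Shortest odd joins\<close>

lemma finite_segments_on: "finite V \<Longrightarrow> finite (segments_on V)"
proof -
  assume "finite V"
  moreover have "segments_on V \<subseteq> (\<lambda>(u, v). closed_segment u v) ` (V \<times> V)"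
    unfolding segments_on_def by auto
  ultimately show ?thesis using finite_subset by blast
qed

lemma geometric_graph_iff: "geometric_graph G \<longleftrightarrow> finite (verts G) \<and> edges G \<subseteq> segments_on (verts G)"
  unfolding geometric_graph_def segments_on_def by blast

lemma endpoints_segments_on: "e \<in> segments_on V \<Longrightarrow> endpoints e \<subseteq> V"
  unfolding segments_on_def by force

text \<open>A T-join with T = V in the graph of visible segments on V. Later V consists of the
  points on one side of the cut, while M may still have edges across it.\<close>

definition odd_join :: "point set set \<Rightarrow> point set \<Rightarrow> point set set \<Rightarrow> bool" where
  "odd_join M V J \<longleftrightarrow> J \<subseteq> segments_on V \<and> (\<forall>e \<in> J. visible M e) \<and> (\<forall>v \<in> V. odd_at J v)"

locale matched_points =
  fixes S :: "point set" and M :: "point set set"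
  assumes fin: "finite S" and gp: "general_position S" and M: "M \<subseteq> segments_on S"
    and disjoint: "\<And>m m'. \<lbrakk>m \<in> M; m' \<in> M; m \<noteq> m'\<rbrakk> \<Longrightarrow> m \<inter> m' = {}"
    and matched: "\<And>v. v \<in> S \<Longrightarrow> \<exists>v'\<in>S. v' \<noteq> v \<and> closed_segment v v' \<in> M"
begin

context
  fixes K J
  assumes K: "convex K" and J: "odd_join M (S \<inter> K) J"
    and J_min: "\<And>J'. odd_join M (S \<inter> K) J' \<Longrightarrow> sum diameter J \<le> sum diameter J'"
begin

lemma J_segments: "J \<subseteq> segments_on (S \<inter> K)"
  and J_visible: "e \<in> J \<Longrightarrow> visible M e"
  and J_odd: "v \<in> S \<inter> K \<Longrightarrow> odd_at J v"
  using J unfolding odd_join_def by auto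

lemma finite_J: "finite J"
  using J_segments finite_segments_on[of "S \<inter> K"] fin finite_subset by blast

text \<open>Replacing B by F modulo 2 gives another odd join. Overlaps of F with the remaining edges
  cancel and can only shorten it, so minimality bounds B by F.\<close>

lemma no_exchange:
  assumes B: "B \<subseteq> J" and F: "F \<subseteq> segments_on (S \<inter> K)" "\<And>e. e \<in> F \<Longrightarrow> visible M e"
    and odd: "\<And>v. odd_at F v = odd_at B v"
  shows "sum diameter B \<le> sum diameter F"
proof -
  define J' where "J' = sym_diff (J - B) F"
  have finB: "finite B" using finite_subset[OF B finite_J] .
  have finF: "finite F" using finite_subset[OF F(1)] finite_segments_on fin by simp
  have eq: "J - B = sym_diff J B" using B by auto
  have "odd_at J' v" if "v \<in> S \<inter> K" for v
  proof -
    have "odd_at J' v = (odd_at (J - B) v \<noteq> odd_at F v)"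
      unfolding J'_def using finite_J finF by (subst odd_at_sym_diff) auto
    moreover have "odd_at (J - B) v = (odd_at J v \<noteq> odd_at B v)"
      using odd_at_sym_diff[OF finite_J finB, of v] by (simp only: eq[symmetric])
    ultimately show ?thesis using J_odd[OF that] odd[of v] by blast
  qed
  then have "odd_join M (S \<inter> K) J'"
    using F J_segments J_visible unfolding odd_join_def J'_def by auto
  then have "sum diameter J \<le> sum diameter J'" by (rule J_min)
  also have "\<dots> \<le> sum diameter (J - B) + sum diameter F"
    unfolding J'_def
  proof (rule sum_sym_diff_le)
    fix e assume "e \<in> (J - B) \<union> F"
    then have "e \<in> segments_on (S \<inter> K)" using J_segments F by auto
    then show "diameter e \<ge> 0" by (rule diameter_segments_on_nonneg)
  qed (use finite_J finF in auto)
  also have "sum diameter (J - B) = sum diameter J - sum diameter B"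
    using B finite_J by (simp add: sum_diff)
  finally show ?thesis by simp
qed

text \<open>At the corner p v q, the M-edge at v falls under the second alternative of
  \<open>unobstructed\<close>, every other M-edge misses v and is not crossed by the visible sides.
  The shortcut would thus beat the two edges. The weak inequality includes the case that one of the
  two edges is the M-edge itself.\<close>

lemma no_two_edges_on_same_side:
  assumes e: "closed_segment v p \<in> J" "closed_segment v q \<in> J" "p \<noteq> q" "v \<noteq> p" "v \<noteq> q"
    and m: "closed_segment v v' \<in> M" "v' \<noteq> v"
    and side: "orient v v' p * orient v v' q \<ge> 0"
  shows False
proof -
  have "endpoints (closed_segment v p) \<subseteq> S \<inter> K" "endpoints (closed_segment v q) \<subseteq> S \<inter> K"
    using e J_segments endpoints_segments_on by (meson subsetD)+
  then have S: "p \<in> S" "q \<in> S" "v \<in> S" "p \<in> K" "q \<in> K" "v \<in> K" by auto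
  have D: "orient p v q \<noteq> 0" using general_position_orient[OF gp, of p v q] S e by auto
  have un: "unobstructed m p v q" if mM: "m \<in> M" for m
  proof (cases "m = closed_segment v v'")
    case True
    have "\<forall>z\<in>m. orient v v' z = 0" using True orient_eq_0_on_segment by auto
    then show ?thesis using m side unfolding unobstructed_def by blast
  next
    case False
    then have vm: "v \<notin> m" using disjoint[OF mM m(1)] by auto
    have "m \<inter> (closed_segment v r - {r}) = {}" if "closed_segment v r \<in> J" for r
    proof -
      have "m \<noteq> closed_segment v r" using vm by auto
      then have "m \<inter> closed_segment v r \<subseteq> {v, r}"
        using J_visible[OF that] mM unfolding visible_def by auto
      then show ?thesis using vm by auto
    qed
    then show ?thesis using e unfolding unobstructed_def by blast
  qed
  obtain F where F: "finite F" "F \<subseteq> segments_on (S \<inter> K)" "\<forall>e\<in>F. visible M e"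
    "\<forall>v. odd_at F v \<longleftrightarrow> v \<in> {p, q}" "sum diameter F < dist p v + dist v q"
    by (rule shortcut[OF fin gp M K S(1,2,4,6,5) D un])
  \<comment> \<open>This is just the pair of edges, written so that \<open>odd_at_sym_diff\<close>
    yields its parities.\<close>
  define B where "B = sym_diff {closed_segment v p} {closed_segment v q}"
  have ne: "closed_segment v p \<noteq> closed_segment v q" using e by (auto simp: closed_segment_eq doubleton_eq_iff)
  have Beq: "B = {closed_segment v p, closed_segment v q}" using ne by (auto simp: B_def)
  have "odd_at F w = odd_at B w" for w
    unfolding B_def F(4)[rule_format] using e by (subst odd_at_sym_diff) auto
  then have "sum diameter B \<le> sum diameter F"
    using no_exchange[of B F] e F Beq by auto
  then show False using F(5) ne by (simp add: Beq dist_commute)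
qed

lemma J_degree_one:
  assumes v: "v \<in> S \<inter> K"
  shows "card {e \<in> J. v \<in> endpoints e} = 1"
proof (rule ccontr)
  define X where "X = {e \<in> J. v \<in> endpoints e}"
  have finX: "finite X" using finite_J by (simp add: X_def)
  assume "card {e \<in> J. v \<in> endpoints e} \<noteq> 1"
  moreover have "odd (card X)" using J_odd[OF v] by (simp add: odd_at_def X_def)
  ultimately have "card X \<ge> 3" unfolding X_def[symmetric] by presburger
  then obtain Y where Y: "Y \<subseteq> X" "card Y = 3" using obtain_subset_with_card_n by metis
  then obtain e1 e2 e3 where e: "Y = {e1, e2, e3}" "e1 \<noteq> e2" "e2 \<noteq> e3" "e1 \<noteq> e3"
    using card_3_iff by metis
  have "\<exists>p. e = closed_segment v p \<and> v \<noteq> p" if "e \<in> Y" for e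
  proof -
    have "e \<in> J" "v \<in> endpoints e" using that Y by (auto simp: X_def)
    then obtain a b where "e = closed_segment a b" "a \<noteq> b" using J_segments unfolding segments_on_def by blast
    then show ?thesis using \<open>v \<in> endpoints e\<close> by (auto simp: closed_segment_commute)
  qed
  then obtain p1 p2 p3 where p: "e1 = closed_segment v p1" "v \<noteq> p1" "e2 = closed_segment v p2" "v \<noteq> p2"
    "e3 = closed_segment v p3" "v \<noteq> p3" using e by (metis insertI1 insertI2)
  have ne: "p1 \<noteq> p2" "p2 \<noteq> p3" "p1 \<noteq> p3" using p e by auto
  have inJ: "closed_segment v p1 \<in> J" "closed_segment v p2 \<in> J" "closed_segment v p3 \<in> J"
    using p e Y by (auto simp: X_def)
  obtain v' where v': "v' \<noteq> v" "closed_segment v v' \<in> M" using matched v by blast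
  have "orient v v' p1 * orient v v' p2 < 0" "orient v v' p2 * orient v v' p3 < 0"
    "orient v v' p1 * orient v v' p3 < 0"
    using no_two_edges_on_same_side[OF _ _ _ _ _ v'(2,1)] inJ ne p by (meson not_le)+
  \<comment> \<open>Three reals cannot have pairwise negative products.\<close>
  then show False by (auto simp: mult_less_0_iff)
qed

text \<open>An M-edge that equals one of the crossing segments lies on a line through x and the end
  p or r of the corner, so the second alternative holds with that end as \<open>u\<close>. Any other
  M-edge can touch the crossing segments only at their endpoints.\<close>

lemma unobstructed_at_crossing:
  assumes e: "closed_segment p q \<in> J" "closed_segment r s \<in> J"
    and x: "x \<in> closed_segment p q" "x \<in> closed_segment r s" "x \<notin> {p, q, r, s}" and mM: "m \<in> M"
  shows "unobstructed m p x r"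
proof -
  have ne: "p \<noteq> q" "r \<noteq> s" using x by auto
  have line: "\<forall>z\<in>closed_segment u w. orient x u z = 0" if "x \<in> closed_segment u w" "u \<noteq> w" for u w
    using orient_on_line[of u w x] that orient_eq_0_on_segment by blast
  consider "m = closed_segment p q" | "m = closed_segment r s"
    | "m \<noteq> closed_segment p q" "m \<noteq> closed_segment r s" by blast
  then show ?thesis
  proof cases
    case 1
    then show ?thesis using line[OF x(1) ne(1)] x unfolding unobstructed_def by (intro disjI2 exI[of _ p]) auto
  next
    case 2
    then show ?thesis using line[OF x(2) ne(2)] x unfolding unobstructed_def by (intro disjI2 exI[of _ r]) auto
  next
    case 3
    have aux: "m \<inter> (closed_segment x u - {u}) = {}"
      if "closed_segment u w \<in> J" "m \<noteq> closed_segment u w" "x \<in> closed_segment u w" "x \<noteq> w" for u w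
    proof -
      have "m \<inter> closed_segment u w \<subseteq> {u, w}"
        using J_visible[OF that(1)] mM that unfolding visible_def by auto
      moreover have "closed_segment x u \<subseteq> closed_segment u w" using that by (simp add: subset_closed_segment)
      ultimately show ?thesis using far_endpoint_notin_subsegment[of x u w] that by blast
    qed
    show ?thesis using aux[of p q] aux[of r s] 3 e x unfolding unobstructed_def by auto
  qed
qed

lemma J_non_crossing:
  assumes e: "e1 \<in> J" "e2 \<in> J" "e1 \<noteq> e2"
  shows "e1 \<inter> e2 \<subseteq> endpoints e1 \<inter> endpoints e2"
proof -
  obtain p q where pq: "e1 = closed_segment p q" "p \<in> S \<inter> K" "q \<in> S \<inter> K" "p \<noteq> q"
    using e J_segments unfolding segments_on_def by blast
  obtain r s where rs: "e2 = closed_segment r s" "r \<in> S \<inter> K" "s \<in> S \<inter> K" "r \<noteq> s"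
    using e J_segments unfolding segments_on_def by blast
  have "closed_segment p q \<inter> closed_segment r s \<subseteq> {p, q} \<inter> {r, s}"
  proof (rule segments_meet_only_in_common_endpoint[OF gp])
    show "closed_segment p q \<noteq> closed_segment r s" using e pq rs by auto
    assume d: "{p, q} \<inter> {r, s} = {}"
    show "closed_segment p q \<inter> closed_segment r s = {}"
    proof (rule ccontr)
      assume "\<not> ?thesis"
      then obtain x where x: "x \<in> closed_segment p q" "x \<in> closed_segment r s" by blast
      have g: "orient p q r \<noteq> 0" "orient p q s \<noteq> 0" "orient r s p \<noteq> 0" "orient r s q \<noteq> 0" "orient q p s \<noteq> 0"
        using general_position_orient[OF gp] pq rs d by auto
      have xn: "x \<notin> {p, q, r, s}"
        using g orient_eq_0_on_segment[OF x(1)] orient_eq_0_on_segment[OF x(2)] by auto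
      have xK: "x \<in> K" using K x pq closed_segment_subset by blast
      have x': "x \<in> closed_segment q p" "x \<in> closed_segment s r" using x by (auto simp: closed_segment_commute)
      have eJ: "closed_segment p q \<in> J" "closed_segment r s \<in> J" "closed_segment q p \<in> J" "closed_segment s r \<in> J"
        using e pq rs by (auto simp: closed_segment_commute)
      have "orient p x r \<noteq> 0" using orient_interior_point[OF x(1) _ g(1)] xn by auto
      then obtain F where F: "finite F" "F \<subseteq> segments_on (S \<inter> K)" "\<forall>e\<in>F. visible M e"
        "\<forall>v. odd_at F v \<longleftrightarrow> v \<in> {p, r}" "sum diameter F < dist p x + dist x r"
        using shortcut[OF fin gp M K, of p r x] unobstructed_at_crossing[OF eJ(1,2) x xn] pq rs xK by blast
      have "orient q x s \<noteq> 0" using orient_interior_point[OF x'(1) _ g(5)] xn by auto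
      moreover have "x \<notin> {q, p, s, r}" using xn by auto
      ultimately obtain G where G: "finite G" "G \<subseteq> segments_on (S \<inter> K)" "\<forall>e\<in>G. visible M e"
        "\<forall>v. odd_at G v \<longleftrightarrow> v \<in> {q, s}" "sum diameter G < dist q x + dist x s"
        using shortcut[OF fin gp M K, of q s x] unobstructed_at_crossing[OF eJ(3,4) x'] pq rs xK by blast
      define B where "B = sym_diff {closed_segment p q} {closed_segment r s}"
      have ne: "closed_segment p q \<noteq> closed_segment r s" using e pq rs by auto
      have Beq: "B = {closed_segment p q, closed_segment r s}" using ne by (auto simp: B_def)
      define H where "H = sym_diff F G"
      \<comment> \<open>The chains join p to r and q to s, the edges p to q and r to s: both
        pairings are odd at the same four points.\<close>
      have "odd_at H w = odd_at B w" for w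
      proof -
        have "odd_at H w = ((w \<in> {p, r}) \<noteq> (w \<in> {q, s}))"
          unfolding H_def using F(4) G(4) odd_at_sym_diff[OF F(1) G(1)] by simp
        moreover have "odd_at B w = ((w \<in> {p, q}) \<noteq> (w \<in> {r, s}))"
          unfolding B_def by (subst odd_at_sym_diff) auto
        ultimately show ?thesis using d pq rs by auto
      qed
      moreover have "H \<subseteq> segments_on (S \<inter> K)" using F(2) G(2) unfolding H_def by blast
      moreover have "visible M e" if "e \<in> H" for e using F(3) G(3) that unfolding H_def by blast
      ultimately have "sum diameter B \<le> sum diameter H"
        using eJ Beq by (intro no_exchange) auto
      also have "\<dots> \<le> sum diameter F + sum diameter G"
        unfolding H_def
      proof (rule sum_sym_diff_le)
        fix e assume "e \<in> F \<union> G"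
        then show "diameter e \<ge> 0" using F G diameter_segments_on_nonneg by blast
      qed (use F G in auto)
      also have "\<dots> < (dist p x + dist x q) + (dist r x + dist x s)"
        using F G by (simp add: dist_commute)
      also have "\<dots> = dist p q + dist r s"
        using x by (simp add: between_mem_segment[symmetric] between)
      also have "\<dots> = sum diameter B" using ne by (simp add: Beq)
      finally show False by simp
    qed
  qed (use pq rs in auto)
  then show ?thesis using pq rs by simp
qed

end

text \<open>Odd joins are subsets of a finite set of segments, so a shortest one exists; by the
  exchange arguments it is already a perfect matching.\<close>

lemma matching_if_odd_join:
  assumes K: "convex K" and J0: "odd_join M (S \<inter> K) J0"
  obtains N where "perfect_matching (S \<inter> K) N" "\<forall>e \<in> edges N. visible M e"
proof -
  define \<J> where "\<J> = Collect (odd_join M (S \<inter> K))"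
  have "\<J> \<subseteq> Pow (segments_on (S \<inter> K))" by (auto simp: \<J>_def odd_join_def)
  then have "finite \<J>" using finite_segments_on[of "S \<inter> K"] fin finite_subset by blast
  moreover have "\<J> \<noteq> {}" using J0 by (auto simp: \<J>_def)
  ultimately obtain J where J: "J \<in> \<J>" "\<And>J'. J' \<in> \<J> \<Longrightarrow> sum diameter J \<le> sum diameter J'"
    using ex_is_arg_min_if_finite[of \<J> "sum diameter"] unfolding is_arg_min_linorder by blast
  then have J': "odd_join M (S \<inter> K) J" "\<And>J'. odd_join M (S \<inter> K) J' \<Longrightarrow> sum diameter J \<le> sum diameter J'"
    by (auto simp: \<J>_def)
  define N where "N = \<lparr>verts = S \<inter> K, edges = J\<rparr>"
  have "geometric_graph N" using J_segments[OF K J'] fin by (simp add: N_def geometric_graph_iff)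
  moreover have "non_crossing N" using J_non_crossing[OF K J'] by (simp add: N_def non_crossing_def)
  moreover have "\<forall>v \<in> S \<inter> K. degree N v = 1" using J_degree_one[OF K J'] by (simp add: N_def degree_def)
  ultimately have "perfect_matching (S \<inter> K) N" by (simp add: perfect_matching_def N_def)
  moreover have "\<forall>e \<in> edges N. visible M e" using J_visible[OF K J'] by (simp add: N_def)
  ultimately show thesis by (rule that)
qed

end

section \<open>Existence of odd joins\<close>

lemma even_card_sym_diff:
  assumes "finite A" "finite B"
  shows "even (card (sym_diff A B)) \<longleftrightarrow> even (card A) = even (card B)"
proof -
  have "card A = card (A - B) + card (A \<inter> B)" "card B = card (B - A) + card (A \<inter> B)"
    using assms by (subst card_Un_disjoint[symmetric]; auto intro: arg_cong[where f=card])+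
  moreover have "card (sym_diff A B) = card (A - B) + card (B - A)"
    using assms by (intro card_Un_disjoint) auto
  ultimately show ?thesis by presburger
qed

lemma inner_segment_gt:
  assumes "x \<in> closed_segment p q" "x \<noteq> p" "inner (u::point) p < inner u q"
  shows "inner u p < inner u x"
proof -
  obtain t where t: "0 \<le> t" "x = (1 - t) *\<^sub>R p + t *\<^sub>R q" using assms(1) unfolding closed_segment_def by blast
  have "t \<noteq> 0" using t assms(2) by auto
  then have "t * (inner u q - inner u p) > 0" using t assms by simp
  then show ?thesis unfolding t by (simp add: inner_add_right algebra_simps)
qed

context matched_points
begin

text \<open>A segment of M that blocks p q may reach below the cut. Its higher end is at least as
  high as the blocking point, hence higher than p, and the whole corner stays above the cut. The
  point reached may therefore differ from q.\<close>

lemma upward_link: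
  assumes p: "p \<in> S" "c < inner u p" and q: "q \<in> S" "inner u p < inner u q"
  obtains a F where "a \<in> S" "inner u p < inner u a" "finite F" "F \<subseteq> segments_on (S \<inter> {z. c < inner u z})"
    "\<And>e. e \<in> F \<Longrightarrow> visible M e" "\<And>v. odd_at F v \<longleftrightarrow> v \<in> {p, a}"
proof (cases "visible M (closed_segment p q)")
  case True
  show thesis
  proof (rule that[of q "{closed_segment p q}"])
    show "{closed_segment p q} \<subseteq> segments_on (S \<inter> {z. c < inner u z})"
      using p q unfolding segments_on_def by fastforce
  qed (use True p q in auto)
next
  case False
  let ?K = "{z. c < inner u z}"
  have pq: "p \<noteq> q" using q by auto
  \<comment> \<open>M-edges at p or q are left out: by general position they do not obstruct p
    q.\<close>
  define Bl where "Bl = {m \<in> M. endpoints m \<inter> {p, q} = {}}"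
  define C where "C = closed_segment p q \<inter> \<Union>Bl"
  \<comment> \<open>Turn at the first point x where p q is blocked, towards the higher end of the blocking segment.\<close>
  obtain a0 b0 where "closed_segment a0 b0 \<in> M" "{a0, b0} \<inter> {p, q} = {}"
     "closed_segment a0 b0 \<inter> closed_segment p q \<noteq> {}"
    using visibleI[OF gp M p(1) q(1) pq] False by blast
  then have "C \<noteq> {}" unfolding C_def Bl_def by fastforce
  moreover have "finite M" using finite_subset[OF M] finite_segments_on fin by blast
  then have "finite Bl" by (simp add: Bl_def)
  then have "closed C" unfolding C_def
  proof (intro closed_Int closed_Union ballI)
    fix m assume "m \<in> Bl"
    then obtain a b where "m = closed_segment a b" using M unfolding Bl_def segments_on_def by blast
    then show "closed m" by simp
  qed auto
  ultimately obtain x where x: "x \<in> C" "\<And>y. y \<in> C \<Longrightarrow> dist p x \<le> dist p y"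
    using distance_attains_inf[of C p] by blast
  then obtain m where m: "m \<in> M" "endpoints m \<inter> {p, q} = {}" "x \<in> m" and xpq: "x \<in> closed_segment p q"
    unfolding C_def Bl_def by auto
  obtain a' b' where ab': "m = closed_segment a' b'" "a' \<in> S" "b' \<in> S" "a' \<noteq> b'"
    using M m unfolding segments_on_def by blast
  have "\<exists>a b. m = closed_segment a b \<and> a \<in> S \<and> b \<in> S \<and> a \<noteq> b \<and> inner u x \<le> inner u a"
  proof -
    have "affine_fun (inner u)" by (simp add: affine_fun_def inner_add_right)
    then have "inner u x \<le> max (inner u a') (inner u b')"
      using affine_fun_segment_le_max m ab' by blast
    then consider "inner u x \<le> inner u a'" | "inner u x \<le> inner u b'" by linarith
    then show ?thesis
    proof cases
      case 1 then show ?thesis using ab' by blast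
    next
      case 2 then show ?thesis using ab' closed_segment_commute by metis
    qed
  qed
  then obtain a b where ab: "m = closed_segment a b" "a \<in> S" "b \<in> S" "a \<noteq> b" "inner u x \<le> inner u a" by blast
  have ne: "{a, b} \<inter> {p, q} = {}" using m ab by simp
  have g: "orient a b p \<noteq> 0" "orient a b q \<noteq> 0" "orient p q a \<noteq> 0"
    using general_position_orient[OF gp] ab p q pq ne by auto
  have "orient a b x = 0" "orient p q x = 0" using orient_eq_0_on_segment m ab xpq by auto
  then have xn: "x \<noteq> p" "x \<noteq> q" "x \<noteq> a" using g by auto
  have ux: "inner u p < inner u x" using inner_segment_gt[OF xpq xn(1) q(2)] .
  have D: "orient p x a \<noteq> 0" using orient_interior_point[OF xpq xn(1) g(3)] .
  have un: "unobstructed m' p x a" if m': "m' \<in> M" for m'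
  proof (cases "m' = m")
    case True
    have "\<forall>z\<in>m'. orient x a z = 0"
      using orient_on_line[of a b x] ab m orient_eq_0_on_segment True by blast
    then show ?thesis using xn unfolding unobstructed_def by (intro disjI2 exI[of _ a]) auto
  next
    case False
    then have dis: "m' \<inter> m = {}" using disjoint m' m by blast
    have "closed_segment x a \<subseteq> m" using m ab by (simp add: subset_closed_segment)
    then have "m' \<inter> (closed_segment x a - {a}) = {}" using dis by blast
    moreover have "m' \<inter> (closed_segment x p - {p}) = {}"
    proof (rule ccontr)
      \<comment> \<open>Another M-edge touching the side x p away from p would block p q at a point
        closer to p than x.\<close>
      assume "\<not> ?thesis"
      then obtain z where z: "z \<in> m'" "z \<in> closed_segment x p" "z \<noteq> p" by blast
      have zpq: "z \<in> closed_segment p q" using z xpq subset_closed_segment[of x p p q] by auto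
      have zq: "z \<noteq> q" using far_endpoint_notin_subsegment[OF xpq xn(2)] z by auto
      obtain r s where rs: "m' = closed_segment r s" "r \<in> S" "s \<in> S" "r \<noteq> s"
        using m' M unfolding segments_on_def by blast
      have "m' \<noteq> closed_segment p q" using xpq dis m by auto
      then have "{r, s} \<inter> {p, q} = {}"
        using segments_meet_only_in_common_endpoint[OF gp, of r s p q] rs p q pq z zpq zq by auto
      then have "z \<in> C" using m' rs z zpq unfolding C_def Bl_def by auto
      then have "dist p x \<le> dist p z" by (rule x(2))
      moreover have "dist x p = dist x z + dist z p"
        using z by (simp add: between_mem_segment[symmetric] between)
      ultimately have "dist x z \<le> 0" by (simp add: dist_commute)
      then show False using dis m z by auto
    qed
    ultimately show ?thesis unfolding unobstructed_def by blast
  qed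
  have inK: "p \<in> ?K" "x \<in> ?K" "a \<in> ?K" using p ux ab by auto
  obtain F where F: "finite F" "F \<subseteq> segments_on (S \<inter> ?K)" "\<forall>e\<in>F. visible M e"
    "\<forall>v. odd_at F v \<longleftrightarrow> v \<in> {p, a}"
    "sum diameter F < dist p x + dist x a"
    by (rule shortcut[OF fin gp M convex_halfspace_gt[of c u] p(1) ab(2) inK D un])
  show thesis by (rule that[of a F]) (use F ux ab in auto)
qed

text \<open>The lowest point p of T is linked upwards to some a, and p and a are toggled in T. This
  raises the lowest point, so fewer points of S lie at or above it. Evenness guarantees a second
  point of T, hence a point higher than p.\<close>

lemma join_for_even_set:
  assumes inj: "inj_on (inner u) S" and T: "T \<subseteq> S \<inter> {z. c < inner u z}" "even (card T)"
  shows "\<exists>F. finite F \<and> F \<subseteq> segments_on (S \<inter> {z. c < inner u z}) \<and> (\<forall>e \<in> F. visible M e) \<and>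
           (\<forall>v. odd_at F v \<longleftrightarrow> v \<in> T)"
  using T
proof (induction "card {v \<in> S. \<exists>w \<in> T. inner u w \<le> inner u v}" arbitrary: T rule: less_induct)
  case less
  have finT: "finite T" using less.prems fin finite_subset by blast
  show ?case
  proof (cases "T = {}")
    case True
    then show ?thesis by (intro exI[of _ "{}"]) (simp add: odd_at_def)
  next
    case False
    then obtain p where p: "p \<in> T" "\<And>w. w \<in> T \<Longrightarrow> inner u p \<le> inner u w"
      using ex_is_arg_min_if_finite[OF finT, of "inner u"] unfolding is_arg_min_linorder by blast
    have pmin: "inner u p < inner u w" if "w \<in> T" "w \<noteq> p" for w
      using p that inj less.prems by (metis IntD1 inj_onD order_le_less subsetD)
    have "T \<noteq> {p}" using less.prems by auto
    then obtain q where "q \<in> T" "q \<noteq> p" using p by auto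
    then have q: "q \<in> S" "inner u p < inner u q" using pmin less.prems by auto
    obtain a F where a: "a \<in> S" "inner u p < inner u a"
      and F: "finite F" "F \<subseteq> segments_on (S \<inter> {z. c < inner u z})"
        "\<And>e. e \<in> F \<Longrightarrow> visible M e" "\<And>v. odd_at F v \<longleftrightarrow> v \<in> {p, a}"
      using upward_link[of p c u q] q p less.prems by blast
    \<comment> \<open>If a was in T already, the link serves both points and a is removed; otherwise
      a takes over from p.\<close>
    define T' where "T' = sym_diff T {p, a}"
    have gt: "inner u p < inner u w" if "w \<in> T'" for w using that pmin a p unfolding T'_def by auto
    have "{v \<in> S. \<exists>w \<in> T'. inner u w \<le> inner u v} \<subset> {v \<in> S. \<exists>w \<in> T. inner u w \<le> inner u v}"
    proof -
      have "{v \<in> S. \<exists>w \<in> T'. inner u w \<le> inner u v} \<subseteq> {v \<in> S. \<exists>w \<in> T. inner u w \<le> inner u v}"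
      proof clarify
        fix v w assume "w \<in> T'" "inner u w \<le> inner u v"
        then have "inner u p \<le> inner u v" using gt[of w] by linarith
        then show "\<exists>w \<in> T. inner u w \<le> inner u v" using p by blast
      qed
      moreover have "p \<in> {v \<in> S. \<exists>w \<in> T. inner u w \<le> inner u v}" using p less.prems by auto
      moreover have "p \<notin> {v \<in> S. \<exists>w \<in> T'. inner u w \<le> inner u v}" using gt by force
      ultimately show ?thesis by blast
    qed
    then have "card {v \<in> S. \<exists>w \<in> T'. inner u w \<le> inner u v} < card {v \<in> S. \<exists>w \<in> T. inner u w \<le> inner u v}"
      using fin by (intro psubset_card_mono) auto
    moreover have "T' \<subseteq> S \<inter> {z. c < inner u z}" using less.prems a p unfolding T'_def by auto
    moreover have "card {p, a} = 2" using a by (metis card_2_iff less_irrefl)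
    then have "even (card T')"
      unfolding T'_def using even_card_sym_diff[of T "{p, a}"] finT less.prems by simp
    ultimately obtain F' where F': "finite F'" "F' \<subseteq> segments_on (S \<inter> {z. c < inner u z})"
        "\<forall>e \<in> F'. visible M e" "\<forall>v. odd_at F' v \<longleftrightarrow> v \<in> T'"
      using less.hyps[of T'] by blast
    have "odd_at (sym_diff F' F) v \<longleftrightarrow> v \<in> T" for v
      using odd_at_sym_diff[OF F'(1) F(1), of v] F(4) F'(4) by (auto simp: T'_def)
    moreover have "finite (sym_diff F' F)" "sym_diff F' F \<subseteq> segments_on (S \<inter> {z. c < inner u z})"
      "\<forall>e \<in> sym_diff F' F. visible M e" using F F' by blast+
    ultimately show ?thesis by blast
  qed
qed

lemma matching_in_halfplane:
  assumes "inj_on (inner u) S" "even (card (S \<inter> {z. c < inner u z}))"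
  obtains N where "perfect_matching (S \<inter> {z. c < inner u z}) N" "\<forall>e \<in> edges N. visible M e"
proof -
  obtain J where J: "odd_join M (S \<inter> {z. c < inner u z}) J"
    using join_for_even_set[OF assms(1) order_refl assms(2)] unfolding odd_join_def by blast
  show thesis by (rule matching_if_odd_join[OF convex_halfspace_gt J]) (rule that)
qed

end

section \<open>Separated matchings\<close>

text \<open>Distinct edges could share only a common endpoint, whose degree would then exceed
  1.\<close>

lemma perfect_matching_disjoint:
  assumes pm: "perfect_matching S G" and e: "e \<in> edges G" "f \<in> edges G" "e \<noteq> f"
  shows "e \<inter> f = {}"
proof (rule ccontr)
  assume "e \<inter> f \<noteq> {}"
  then obtain v where v: "v \<in> endpoints e" "v \<in> endpoints f"
    using pm e unfolding perfect_matching_def non_crossing_def by blast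
  moreover have "endpoints e \<subseteq> S"
    using pm e endpoints_segments_on unfolding perfect_matching_def geometric_graph_iff by blast
  ultimately have "card {e \<in> edges G. v \<in> endpoints e} = 1"
    using pm unfolding perfect_matching_def degree_def by blast
  then obtain g where "{e \<in> edges G. v \<in> endpoints e} = {g}" using card_1_singletonE by blast
  then have "e = g" "f = g" using e v by blast+
  then show False using e by simp
qed

lemma matched_points_perfect_matching:
  assumes pm: "perfect_matching S G" and gp: "general_position S"
  shows "matched_points S (edges G)"
proof
  show "finite S" "edges G \<subseteq> segments_on S"
    using pm unfolding perfect_matching_def geometric_graph_iff by auto
  show "m \<inter> m' = {}" if "m \<in> edges G" "m' \<in> edges G" "m \<noteq> m'" for m m'
    using perfect_matching_disjoint[OF pm that] .
  fix v assume v: "v \<in> S"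
  then have "card {e \<in> edges G. v \<in> endpoints e} = 1"
    using pm unfolding perfect_matching_def degree_def by blast
  then obtain e where "{e \<in> edges G. v \<in> endpoints e} = {e}" using card_1_singletonE by blast
  then have e: "e \<in> edges G" "v \<in> endpoints e" by auto
  then obtain a b where ab: "e = closed_segment a b" "a \<in> S" "b \<in> S" "a \<noteq> b"
    using pm unfolding perfect_matching_def geometric_graph_iff segments_on_def by blast
  then have "v = a \<or> v = b" using e by simp
  then show "\<exists>v'\<in>S. v' \<noteq> v \<and> closed_segment v v' \<in> edges G"
    using ab e closed_segment_commute by metis
qed (rule gp)

lemma segments_on_separated:
  fixes u :: point
  assumes "e \<in> segments_on A" "f \<in> segments_on B"
    and "\<And>z. z \<in> A \<Longrightarrow> inner u z < c" "\<And>z. z \<in> B \<Longrightarrow> c < inner u z"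
  shows "e \<inter> f = {}"
proof -
  obtain a a' where a: "e = closed_segment a a'" "a \<in> A" "a' \<in> A" using assms(1) unfolding segments_on_def by blast
  obtain b b' where b: "f = closed_segment b b'" "b \<in> B" "b' \<in> B" using assms(2) unfolding segments_on_def by blast
  have "e \<subseteq> {z. inner u z < c}" using a assms(3) convex_halfspace_lt[of u c] by (simp add: closed_segment_subset)
  moreover have "f \<subseteq> {z. c < inner u z}" using b assms(4) convex_halfspace_gt[of c u] by (simp add: closed_segment_subset)
  ultimately show ?thesis by fastforce
qed

lemma non_crossing_union_separated:
  fixes u :: point
  assumes "non_crossing G" "non_crossing H" "edges G \<subseteq> segments_on A" "edges H \<subseteq> segments_on B"
    and "\<And>z. z \<in> A \<Longrightarrow> inner u z < c" "\<And>z. z \<in> B \<Longrightarrow> c < inner u z"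
  shows "non_crossing (graph_union G H)"
proof -
  have "e \<inter> f = {}" "f \<inter> e = {}" if "e \<in> edges G" "f \<in> edges H" for e f
    using segments_on_separated[of e A f B u c] assms that by blast+
  then show ?thesis
    using assms(1,2) unfolding non_crossing_def graph_union_def by (auto; blast)
qed

lemma segments_on_mono: "A \<subseteq> B \<Longrightarrow> segments_on A \<subseteq> segments_on B"
  unfolding segments_on_def by blast

lemma perfect_matching_union_separated:
  fixes u :: point
  assumes G: "perfect_matching A G" and H: "perfect_matching B H"
    and sep: "\<And>z. z \<in> A \<Longrightarrow> inner u z < c" "\<And>z. z \<in> B \<Longrightarrow> c < inner u z"
  shows "perfect_matching (A \<union> B) (graph_union G H)"
proof -
  have G': "finite A" "verts G = A" "edges G \<subseteq> segments_on A" "non_crossing G"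
    and H': "finite B" "verts H = B" "edges H \<subseteq> segments_on B" "non_crossing H"
    using G H unfolding perfect_matching_def geometric_graph_iff by auto
  have "A \<inter> B = {}" using sep by fastforce
  have "{e \<in> edges G \<union> edges H. v \<in> endpoints e} = {e \<in> edges G. v \<in> endpoints e}" if "v \<in> A" for v
    using that endpoints_segments_on H'(3) \<open>A \<inter> B = {}\<close> by blast
  then have 1: "degree (graph_union G H) v = 1" if "v \<in> A" for v
    using G that unfolding perfect_matching_def degree_def graph_union_def by simp
  have "{e \<in> edges G \<union> edges H. v \<in> endpoints e} = {e \<in> edges H. v \<in> endpoints e}" if "v \<in> B" for v
    using that endpoints_segments_on G'(3) \<open>A \<inter> B = {}\<close> by blast
  then have 2: "degree (graph_union G H) v = 1" if "v \<in> B" for v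
    using H that unfolding perfect_matching_def degree_def graph_union_def by simp
  have "edges G \<union> edges H \<subseteq> segments_on (A \<union> B)"
    using G' H' segments_on_mono[of A "A \<union> B"] segments_on_mono[of B "A \<union> B"] by blast
  then have "geometric_graph (graph_union G H)"
    using G' H' unfolding geometric_graph_iff graph_union_def by simp
  moreover have "non_crossing (graph_union G H)"
    using non_crossing_union_separated[of G H A B u c] G' H' sep by blast
  ultimately show ?thesis using 1 2 G' H' unfolding perfect_matching_def by (auto simp: graph_union_def)
qed

lemma compatible_perfect_matchings:
  assumes "perfect_matching S G" "perfect_matching S H"
  shows "compatible G H \<longleftrightarrow> non_crossing (graph_union G H)"
  using assms unfolding compatible_def perfect_matching_def by auto

text \<open>Regrouping the four edge sets by sides leaves one non-crossing union on each side of the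
  line. So transformations on the two sides may advance simultaneously.\<close>

lemma compatible_union_separated:
  fixes u :: point
  assumes G: "perfect_matching A G" "perfect_matching A G'" "compatible G G'"
    and H: "perfect_matching B H" "perfect_matching B H'" "compatible H H'"
    and sep: "\<And>z. z \<in> A \<Longrightarrow> inner u z < c" "\<And>z. z \<in> B \<Longrightarrow> c < inner u z"
  shows "compatible (graph_union G H) (graph_union G' H')"
proof -
  have "non_crossing (graph_union (graph_union G G') (graph_union H H'))"
  proof (rule non_crossing_union_separated[OF _ _ _ _ sep])
    show "non_crossing (graph_union G G')" "non_crossing (graph_union H H')"
      using G(3) H(3) unfolding compatible_def by auto
    show "edges (graph_union G G') \<subseteq> segments_on A" "edges (graph_union H H') \<subseteq> segments_on B"
      using G(1,2) H(1,2) unfolding perfect_matching_def geometric_graph_iff graph_union_def by auto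
  qed
  then have "non_crossing (graph_union (graph_union G H) (graph_union G' H'))"
    unfolding non_crossing_def graph_union_def by (simp add: Un_ac)
  then show ?thesis
    using compatible_perfect_matchings perfect_matching_union_separated[OF G(1) H(1) sep]
      perfect_matching_union_separated[OF G(2) H(2) sep] by blast
qed

lemma split_matching:
  fixes u :: point
  assumes pm: "perfect_matching S M" and gp: "general_position S" and inj: "inj_on (inner u) S"
    and even: "even (card {z \<in> S. inner u z < c})" "even (card {z \<in> S. c < inner u z})"
    and sep: "\<And>z. z \<in> S \<Longrightarrow> inner u z \<noteq> c"
  obtains N1 N2 where "perfect_matching {z \<in> S. inner u z < c} N1"
    "perfect_matching {z \<in> S. c < inner u z} N2" "compatible M (graph_union N1 N2)"
proof -
  interpret matched_points S "edges M" by (rule matched_points_perfect_matching[OF pm gp])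
  define A where "A = {z \<in> S. inner u z < c}"
  define B where "B = {z \<in> S. c < inner u z}"
  \<comment> \<open>The lower side is the upper side for the reversed direction, so one half-plane
    lemma serves both.\<close>
  have Aeq: "A = S \<inter> {z. - c < inner (- u) z}" and Beq: "B = S \<inter> {z. c < inner u z}"
    by (auto simp: A_def B_def)
  have "inj_on (inner (- u)) S" using inj by (auto simp: inj_on_def)
  moreover have "even (card (S \<inter> {z. - c < inner (- u) z}))" unfolding Aeq[symmetric] A_def by (rule even(1))
  ultimately obtain N1 where "perfect_matching (S \<inter> {z. - c < inner (- u) z}) N1"
    and vis1: "\<forall>e \<in> edges N1. visible (edges M) e" by (rule matching_in_halfplane)
  then have pm1: "perfect_matching A N1" by (simp only: Aeq)
  have "even (card (S \<inter> {z. c < inner u z}))" unfolding Beq[symmetric] B_def by (rule even(2))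
  with inj obtain N2 where "perfect_matching (S \<inter> {z. c < inner u z}) N2"
    and vis2: "\<forall>e \<in> edges N2. visible (edges M) e" by (rule matching_in_halfplane)
  then have pm2: "perfect_matching B N2" by (simp only: Beq)
  have "A \<union> B = S" using sep by (force simp: A_def B_def)
  then have pmN: "perfect_matching S (graph_union N1 N2)"
    using perfect_matching_union_separated[OF pm1 pm2, of u c] by (auto simp: A_def B_def)
  have "non_crossing (graph_union M (graph_union N1 N2))"
  proof -
    have N: "visible (edges M) e" if "e \<in> edges (graph_union N1 N2)" for e
      using that vis1 vis2 by (auto simp: graph_union_def)
    have "e \<inter> f \<subseteq> endpoints e \<inter> endpoints f"
      if "e \<in> edges M \<union> edges (graph_union N1 N2)" "f \<in> edges M \<union> edges (graph_union N1 N2)" "e \<noteq> f" for e f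
    proof -
      have nc: "non_crossing M" "non_crossing (graph_union N1 N2)" using pm pmN unfolding perfect_matching_def by auto
      consider "e \<in> edges M" "f \<in> edges M" | "e \<in> edges (graph_union N1 N2)" "f \<in> edges (graph_union N1 N2)"
        | "e \<in> edges M" "f \<in> edges (graph_union N1 N2)" | "f \<in> edges M" "e \<in> edges (graph_union N1 N2)"
        using \<open>e \<in> _\<close> \<open>f \<in> _\<close> by blast
      then show ?thesis
      proof cases
        case 1 then show ?thesis using nc(1) \<open>e \<noteq> f\<close> unfolding non_crossing_def by blast
      next
        case 2 then show ?thesis using nc(2) \<open>e \<noteq> f\<close> unfolding non_crossing_def by blast
      next
        case 3 then show ?thesis using N[of f] \<open>e \<noteq> f\<close> unfolding visible_def by blast
      next
        case 4 then show ?thesis using N[of e] \<open>e \<noteq> f\<close> unfolding visible_def by blast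
      qed
    qed
    then show ?thesis unfolding non_crossing_def graph_union_def[of M] by simp
  qed
  then have "compatible M (graph_union N1 N2)" using compatible_perfect_matchings[OF pm pmN] by blast
  then show thesis using that pm1 pm2 unfolding A_def B_def by blast
qed

section \<open>Choice of the cut and of the direction\<close>

lemma ex_threshold:
  fixes A :: "real set"
  assumes "finite A" "j \<le> card A"
  shows "\<exists>c. c \<notin> A \<and> card {a \<in> A. a < c} = j"
  using assms
proof (induction A arbitrary: j rule: finite_linorder_max_induct)
  case empty then show ?case by simp
next
  case (insert b A)
  have bA: "b \<notin> A" using insert by auto
  consider "j < card A" | "j = card A" | "j = Suc (card A)" using insert bA by (simp, linarith)
  then show ?case
  proof cases
    case 1
    then obtain c where c: "c \<notin> A" "card {a \<in> A. a < c} = j" using insert.IH[of j] by auto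
    have "\<not> A \<subseteq> {a \<in> A. a < c}" using 1 c insert(1) by (metis card_mono finite_Collect_conjI leD Collect_mem_eq)
    then obtain a where "a \<in> A" "\<not> a < c" by auto
    then have "c < b" using insert(2) by fastforce
    then have "{a \<in> insert b A. a < c} = {a \<in> A. a < c}" by auto
    then show ?thesis using c \<open>c < b\<close> by (intro exI[of _ c]) auto
  next
    case 2
    \<comment> \<open>The threshold is put halfway between the largest element of A and b;
      \<open>b - 1\<close> stands in for the maximum when A is empty.\<close>
    define d where "d = Max (insert (b - 1) A)"
    have "d < b" using insert by (auto simp: d_def)
    moreover have "a \<le> d" if "a \<in> A" for a using insert(1) that by (auto simp: d_def)
    ultimately have lt: "a < (d + b) / 2" "(d + b) / 2 < b" if "a \<in> A" for a using that by fastforce+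
    have db: "(d + b) / 2 < b" using \<open>d < b\<close> by simp
    have "{a \<in> insert b A. a < (d + b) / 2} = A" using lt db by auto
    moreover have "(d + b) / 2 \<notin> insert b A" using lt(1)[of "(d + b) / 2"] db by (metis insertE less_irrefl)
    ultimately show ?thesis using 2 by metis
  next
    case 3
    have "{a \<in> insert b A. a < b + 1} = insert b A" using insert(2) by fastforce
    moreover have "b + 1 \<notin> insert b A" using insert(2) by fastforce
    ultimately show ?thesis using 3 insert(1) bA by (metis card_insert_disjoint)
  qed
qed

lemma ex_injective_direction:
  assumes "finite (S :: point set)"
  obtains u :: point where "inj_on (inner u) S"
proof -
  \<comment> \<open>Two points are level for the direction (1, t) only if t is one of these
    quotients, or if they coincide. Pairs with equal second coordinates contribute the default value
    0 of division by zero, which merely excludes \<open>t = 0\<close>.\<close>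
  define bad where "bad = (\<lambda>(a, b). - (a$1 - b$1) / (a$2 - b$2)) ` (S \<times> S)"
  have "finite bad" using assms by (simp add: bad_def)
  then obtain t where t: "t \<notin> bad" using ex_new_if_finite infinite_UNIV_char_0 by blast
  define u :: point where "u = vector [1, t]"
  have "inj_on (inner u) S"
  proof (rule inj_onI)
    fix a b assume ab: "a \<in> S" "b \<in> S" "inner u a = inner u b"
    have eq: "(a$1 - b$1) + t * (a$2 - b$2) = 0"
      using ab(3) by (simp add: u_def inner_vec_def sum_2 algebra_simps)
    have "a$2 = b$2"
    proof (rule ccontr)
      assume "a$2 \<noteq> b$2"
      then have "t = - (a$1 - b$1) / (a$2 - b$2)" using eq by (simp add: field_simps)
      then show False using t ab unfolding bad_def by force
    qed
    then show "a = b" using eq by (simp add: vec_eq_iff forall_2)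
  qed
  then show thesis using that by blast
qed

section \<open>Common targets\<close>

lemma general_position_subset: "general_position S \<Longrightarrow> T \<subseteq> S \<Longrightarrow> general_position T"
  unfolding general_position_def by blast

lemma compatible_commute: "compatible G H \<Longrightarrow> compatible H G"
  unfolding compatible_def graph_union_def non_crossing_def by (auto simp: Un_commute)

text \<open>The halving stops here. The empty set has to be included because a single pair is split
  into 0 and 1 pairs if rounds are left over.\<close>

lemma unique_matching_at_most_two:
  assumes fin: "finite S" and card: "card S = 2 * m" "m \<le> 1"
  obtains N where "perfect_matching S N" "\<forall>M. perfect_matching S M \<longrightarrow> M = N"
proof (cases "m = 0")
  case True
  then have S: "S = {}" using fin card by simp
  show thesis
  proof (rule that[of "\<lparr>verts = {}, edges = {}\<rparr>"])
    show "perfect_matching S \<lparr>verts = {}, edges = {}\<rparr>"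
      by (simp add: S perfect_matching_def geometric_graph_def non_crossing_def)
    have "M = \<lparr>verts = {}, edges = {}\<rparr>" if "perfect_matching S M" for M
      using that by (cases M) (auto simp: S perfect_matching_def geometric_graph_def)
    then show "\<forall>M. perfect_matching S M \<longrightarrow> M = \<lparr>verts = {}, edges = {}\<rparr>" by blast
  qed
next
  case False
  then have "card S = 2" using card by simp
  then obtain a b where S: "S = {a, b}" "a \<noteq> b" using card_2_iff by metis
  have seg: "segments_on S = {closed_segment a b}"
    using S by (auto simp: segments_on_def closed_segment_commute)
  show thesis
  proof (rule that[of "\<lparr>verts = S, edges = {closed_segment a b}\<rparr>"])
    have "{e. e = closed_segment a b \<and> v \<in> endpoints e} = {closed_segment a b}" if "v \<in> S" for v
      using that S by auto
    then show "perfect_matching S \<lparr>verts = S, edges = {closed_segment a b}\<rparr>"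
      using fin by (auto simp: seg perfect_matching_def geometric_graph_iff non_crossing_def degree_def)
    have "M = \<lparr>verts = S, edges = {closed_segment a b}\<rparr>" if M: "perfect_matching S M" for M
    proof -
      have "edges M \<subseteq> segments_on S" using M unfolding perfect_matching_def geometric_graph_iff by auto
      then have "edges M \<subseteq> {closed_segment a b}" by (simp only: seg)
      moreover have "edges M \<noteq> {}" using M S by (auto simp: perfect_matching_def degree_def)
      ultimately have "edges M = {closed_segment a b}" by blast
      then show ?thesis using M by (cases M) (simp add: perfect_matching_def)
    qed
    then show "\<forall>M. perfect_matching S M \<longrightarrow> M = \<lparr>verts = S, edges = {closed_segment a b}\<rparr>" by blast
  qed
qed

text \<open>N is chosen before M. The length is exactly k, not at most k, so that the
  transformations of the two parts have equal length and can run in parallel.\<close>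

lemma ex_common_target:
  fixes u :: point
  assumes "finite S" "general_position S" "inj_on (inner u) S" "card S = 2 * m" "m \<le> 2 ^ k"
  shows "\<exists>N. perfect_matching S N \<and> (\<forall>M. perfect_matching S M \<longrightarrow> (\<exists>Ms. transformation S M N k Ms))"
  using assms
proof (induction k arbitrary: S m)
  case 0
  then have "m \<le> 1" by simp
  with 0(1,4) obtain N where N: "perfect_matching S N" "\<forall>M. perfect_matching S M \<longrightarrow> M = N"
    by (rule unique_matching_at_most_two)
  have "transformation S N N 0 (\<lambda>_. N)" using N(1) by (simp add: transformation_def)
  then show ?case using N by metis
next
  case (Suc k)
  \<comment> \<open>Counting pairs, the parts receive the lower and upper half of m; both are at
    most \<open>2 ^ k\<close> since \<open>2 ^ Suc k\<close> is even.\<close>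
  define j where "j = m div 2"
  have "card (inner u ` S) = 2 * m" using Suc.prems by (simp add: card_image)
  then obtain c where c: "c \<notin> inner u ` S" "card {a \<in> inner u ` S. a < c} = 2 * j"
    using ex_threshold[of "inner u ` S" "2 * j"] Suc.prems by (auto simp: j_def)
  define A where "A = {z \<in> S. inner u z < c}"
  define B where "B = {z \<in> S. c < inner u z}"
  have "{a \<in> inner u ` S. a < c} = inner u ` A" by (auto simp: A_def)
  moreover have injA: "inj_on (inner u) A" and injB: "inj_on (inner u) B"
    using Suc.prems(3) by (auto simp: A_def B_def inj_on_def)
  ultimately have cardA: "card A = 2 * j" using c(2) by (simp add: card_image)
  have fin: "finite A" "finite B" using Suc.prems by (auto simp: A_def B_def)
  have ne: "inner u z \<noteq> c" if "z \<in> S" for z using c(1) that by blast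
  have AB: "S = A \<union> B" "A \<inter> B = {}" using ne by (force simp: A_def B_def)+
  then have "card S = card A + card B" using fin by (simp add: card_Un_disjoint)
  then have cardB: "card B = 2 * (m - j)" using cardA Suc.prems by simp
  have gpAB: "general_position A" "general_position B"
    using general_position_subset[OF Suc.prems(2)] AB by auto
  have le: "j \<le> 2 ^ k" "m - j \<le> 2 ^ k" using Suc.prems(5) by (auto simp: j_def)
  have sep: "\<And>z. z \<in> A \<Longrightarrow> inner u z < c" "\<And>z. z \<in> B \<Longrightarrow> c < inner u z" by (auto simp: A_def B_def)
  obtain N1 where N1: "perfect_matching A N1"
    "\<forall>M. perfect_matching A M \<longrightarrow> (\<exists>Ms. transformation A M N1 k Ms)"
    using Suc.IH[OF fin(1) gpAB(1) injA cardA le(1)] by blast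
  obtain N2 where N2: "perfect_matching B N2"
    "\<forall>M. perfect_matching B M \<longrightarrow> (\<exists>Ms. transformation B M N2 k Ms)"
    using Suc.IH[OF fin(2) gpAB(2) injB cardB le(2)] by blast
  have pm: "perfect_matching S (graph_union G H)" if "perfect_matching A G" "perfect_matching B H" for G H
    using perfect_matching_union_separated[OF that sep] AB by simp
  have "\<exists>Ms. transformation S M (graph_union N1 N2) (Suc k) Ms" if M: "perfect_matching S M" for M
  proof -
    have ev: "even (card {z \<in> S. inner u z < c})" "even (card {z \<in> S. c < inner u z})"
      using cardA cardB unfolding A_def B_def by simp_all
    obtain M1 M2 where M12: "perfect_matching A M1" "perfect_matching B M2" "compatible M (graph_union M1 M2)"
      unfolding A_def B_def by (rule split_matching[OF M Suc.prems(2,3) ev ne])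
    obtain P where P: "transformation A M1 N1 k P" using N1 M12 by blast
    obtain Q where Q: "transformation B M2 N2 k Q" using N2 M12 by blast
    \<comment> \<open>One step clears the cut; afterwards both sides follow their own
      transformation, delayed by one.\<close>
    define Ms where "Ms i = (if i = 0 then M else graph_union (P (i - 1)) (Q (i - 1)))" for i
    have "perfect_matching S (Ms i)" if "i \<le> Suc k" for i
      using that M P Q unfolding Ms_def transformation_def by (auto intro!: pm)
    moreover have "compatible (Ms i) (Ms (Suc i))" if "i < Suc k" for i
    proof (cases i)
      case 0 then show ?thesis using M12 P Q by (simp add: Ms_def transformation_def)
    next
      case (Suc i')
      then have i': "i' < k" using that by simp
      have "compatible (graph_union (P i') (Q i')) (graph_union (P (Suc i')) (Q (Suc i')))"
        by (rule compatible_union_separated[OF _ _ _ _ _ _ sep])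
          (use P Q i' in \<open>auto simp: transformation_def\<close>)
      then show ?thesis using Suc by (simp add: Ms_def)
    qed
    ultimately have "transformation S M (graph_union N1 N2) (Suc k) Ms"
      using P Q unfolding transformation_def by (simp add: Ms_def)
    then show ?thesis by blast
  qed
  then show ?case using pm[OF N1(1) N2(1)] by blast
qed

text \<open>Compatibility is symmetric, so Q can be traversed backwards from N.\<close>

lemma transformation_via_common_target:
  assumes P: "transformation S M N k P" and Q: "transformation S M' N k Q"
  shows "transformation S M M' (2 * k) (\<lambda>i. if i \<le> k then P i else Q (2 * k - i))"
proof -
  define R where "R i = (if i \<le> k then P i else Q (2 * k - i))" for i
  have "perfect_matching S (R i)" if "i \<le> 2 * k" for i
    using that P Q by (auto simp: R_def transformation_def)
  moreover have "compatible (R i) (R (Suc i))" if i: "i < 2 * k" for i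
  proof (cases "i < k")
    case True then show ?thesis using P by (simp add: R_def transformation_def)
  next
    case False
    define j where "j = 2 * k - Suc i"
    have j: "j < k" "2 * k - i = Suc j" "2 * k - Suc i = j" using False i by (auto simp: j_def)
    have "compatible (Q (Suc j)) (Q j)" using Q j by (simp add: transformation_def compatible_commute)
    moreover have "R i = Q (Suc j)"
    \<comment> \<open>At the seam the sequence is still given by P, but \<open>P k\<close> and
      \<open>Q k\<close> are both N.\<close>
    proof (cases "i = k")
      case True
      then have "Suc j = k" using j by simp
      then show ?thesis using P Q True by (simp add: R_def transformation_def)
    next
      case False then show ?thesis using \<open>\<not> i < k\<close> j by (simp add: R_def)
    qed
    moreover have "R (Suc i) = Q j" using False j by (simp add: R_def)
    ultimately show ?thesis by simp
  qed
  moreover have "R 0 = M" "R (2 * k) = M'" using P Q by (auto simp: R_def transformation_def)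
  ultimately have "transformation S M M' (2 * k) R" unfolding transformation_def by blast
  then show ?thesis by (simp add: R_def[abs_def])
qed

theorem theorem4:
  fixes S :: "point set" and n :: nat and M M' :: geom_graph
  assumes "finite S" and "card S = 2 * n" and "n \<ge> 1"
    and "general_position S"
    and "perfect_matching S M" and "perfect_matching S M'"
  shows "\<exists>k Ms. transformation S M M' k Ms \<and> int k \<le> 2 * \<lceil>log 2 (real n)\<rceil>"
proof -
  define k where "k = nat \<lceil>log 2 (real n)\<rceil>"
  \<comment> \<open>Since n is at least 1 the ceiling is nonnegative, and \<open>nat\<close> loses
    nothing.\<close>
  have "log 2 (real n) \<ge> 0" using assms(3) by simp
  then have k: "int k = \<lceil>log 2 (real n)\<rceil>" by (simp add: k_def)
  then have "log 2 (real n) \<le> real k" by linarith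
  then have "real n \<le> 2 powr real k" using assms(3) by (simp add: log_le_iff)
  then have "real n \<le> real (2 ^ k)" by (simp add: powr_realpow)
  then have "n \<le> 2 ^ k" by (simp only: of_nat_le_iff)
  obtain u where "inj_on (inner u) S" using ex_injective_direction[OF assms(1)] by blast
  from ex_common_target[OF assms(1,4) this assms(2) \<open>n \<le> 2 ^ k\<close>]
  obtain N P Q where "transformation S M N k P" "transformation S M' N k Q"
    using assms(5,6) by blast
  then have "transformation S M M' (2 * k) (\<lambda>i. if i \<le> k then P i else Q (2 * k - i))"
    by (rule transformation_via_common_target)
  moreover have "int (2 * k) \<le> 2 * \<lceil>log 2 (real n)\<rceil>" using k by simp
  ultimately show ?thesis by blast
qed

end
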